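(* Let $\Omega\subset\mathbb{R}^2$ be a smooth bounded domain whose boundary components are closed curves without self-intersections, and let $b:\Omega\to\mathbb{R}$ be a locally Lipschitz magnetic field. For every connected component $\mathcal{C}$ of $\partial\Omega$, let $L_{\mathcal{C}}$ be its length, let $\delta_{\mathcal{C}}>0$ be the width of a tubular coordinate chart $(n,s)\in(0,\delta_{\mathcal{C}})\times\mathbb{R}/L_{\mathcal{C}}\mathbb{Z}$ near $\mathcal{C}$, and let $B=B(n,s)$ be the magnetic field read in these coordinates (see context). Assume that for every connected component $\mathcal{C}$ of $\partial\Omega$, $$\lim_{n\to 0}\left|\int_n^{\delta_{\mathcal{C}}}\int_0^{L_{\mathcal{C}}}B(\eta,\xi)\,\mathrm{d}\xi\,\mathrm{d}\eta\right|=+\infty,$$ and that there exists $M_{\mathcal{C}}\ge 0$ such that for all $(n,s)\in(0,\delta_{\mathcal{C}})\times\mathbb{R}/L_{\mathcal{C}}\mathbb{Z}$, $$\left|B(n,s)-\frac{1}{L_{\mathcal{C}}}\int_0^{L_{\mathcal{C}}}B(n,\xi)\,\mathrm{d}\xi\right|\le M_{\mathcal{C}}.$$ Then the magnetic Hamiltonian dynamics is complete, i.e. no solution of the magnetic equations of motion starting in $\Omega$ reaches $\partial\Omega$ in finite time.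
   Context: **Dynamics.** The particle has unit charge and mass and moves in $\Omega$ according to Newton's equation $\ddot q=b(q)\,(\dot q_2,-\dot q_1)$, where $q=(q_1,q_2)$. Equivalently, if $\mathbf{A}=(A_1,A_2)$ is a vector potential with $\partial_{q_1}A_2-\partial_{q_2}A_1=b$ and $p=\dot q+\mathbf{A}(q)$, then $(q,p)$ follows the Hamiltonian flow $\dot q=\partial_p\mathcal{H}$, $\dot p=-\partial_q\mathcal{H}$ of $\mathcal{H}(q,p)=\frac12\|p-\mathbf{A}(q)\|^2$. Since $b$ is locally Lipschitz, there is a unique maximal solution for every initial condition. **Tubular coordinates.** Let $\mathcal{C}$ be a connected component of $\partial\Omega$ and let $\gamma:\mathbb{R}/L\mathbb{Z}\to\mathcal{C}$ be its arc-length parametrization, where $L=L_{\mathcal{C}}$. Let $N(s)$ be the inward pointing unit normal at $\gamma(s)$, with $\gamma$ oriented so that $(\gamma'(s),N(s))$ is a direct orthonormal basis. Let $\kappa(s)$ be the signed curvature, $\gamma''(s)=\kappa(s)N(s)$. The number $\delta=\delta_{\mathcal{C}}>0$ is chosen such that $\psi(n,s)=\gamma(s)+nN(s)$ is a smooth diffeomorphism from $(0,\delta)\times\mathbb{R}/L\mathbb{Z}$ onto $\Omega_{\mathcal{C}}(\delta)=\{q\in\Omega:\mathrm{dist}(q,\mathcal{C})<\delta\}$. In these coordinates, $$B(n,s):=-\,b(\psi(n,s))\,(1-n\kappa(s)).$$ It is understood that $\delta$ is such that the integrals $\int_n^{\delta}\int_0^LB\,\mathrm{d}\xi\,\mathrm{d}\eta$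 with $0<n<\delta$ are well defined and finite. *)

theory Defs
  imports "HOL-Analysis.Analysis"
begin

section \<open>Smooth maps and smooth domains\<close>

text \<open>Meant for open \<open>S\<close>.  In finite dimension, continuity of all directional derivatives of
  order up to \<open>k\<close> is the usual class \<open>C\<^sup>k\<close>.\<close>

primrec Ck_on :: "nat \<Rightarrow> ('a::euclidean_space \<Rightarrow> 'b::euclidean_space) \<Rightarrow> 'a set \<Rightarrow> bool" where
  "Ck_on 0 f S \<longleftrightarrow> continuous_on S f"
| "Ck_on (Suc k) f S \<longleftrightarrow>
     f differentiable_on S \<and> (\<forall>v. Ck_on k (\<lambda>x. frechet_derivative f (at x) v) S)"

definition smooth_on :: "'a set \<Rightarrow> ('a::euclidean_space \<Rightarrow> 'b::euclidean_space) \<Rightarrow> bool" where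
  "smooth_on S f \<longleftrightarrow> (\<forall>k. Ck_on k f S)"

text \<open>The boundary is smooth in the sense of local defining functions with nonvanishing
  differential; in particular the domain lies on one side of its boundary.\<close>

definition smooth_bounded_domain :: "(real^2) set \<Rightarrow> bool" where
  "smooth_bounded_domain \<Omega> \<longleftrightarrow>
     open \<Omega> \<and> connected \<Omega> \<and> \<Omega> \<noteq> {} \<and> bounded \<Omega> \<and>
     (\<forall>z\<in>frontier \<Omega>. \<exists>U (\<rho> :: real^2 \<Rightarrow> real).
        open U \<and> z \<in> U \<and> smooth_on U \<rho> \<and>
        (\<forall>x\<in>U. frechet_derivative \<rho> (at x) \<noteq> (\<lambda>_. 0)) \<and>
        \<Omega> \<inter> U = {x\<in>U. \<rho> x < 0})"

section \<open>Boundary curves and tubular coordinates\<close>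

text \<open>Maps on the circle \<open>\<real>/L\<int>\<close> are represented by \<open>L\<close>-periodic maps on the line.\<close>

definition arclength_parametrization ::
    "(real \<Rightarrow> real^2) \<Rightarrow> real \<Rightarrow> (real^2) set \<Rightarrow> bool" where
  "arclength_parametrization \<gamma> L C \<longleftrightarrow>
     L > 0 \<and> smooth_on UNIV \<gamma> \<and> (\<forall>s. \<gamma> (s + L) = \<gamma> s) \<and>
     inj_on \<gamma> {0..<L} \<and> range \<gamma> = C \<and>
     (\<forall>s. norm (vector_derivative \<gamma> (at s)) = 1)"

text \<open>The unit vector \<open>N\<close> for which \<open>(\<gamma>', N)\<close> is a direct orthonormal basis.\<close>

definition unit_normal :: "(real \<Rightarrow> real^2) \<Rightarrow> real \<Rightarrow> real^2" where
  "unit_normal \<gamma> s =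
     (let t = vector_derivative \<gamma> (at s) in vector [- (t $ 2), t $ 1])"

definition signed_curvature :: "(real \<Rightarrow> real^2) \<Rightarrow> real \<Rightarrow> real" where
  "signed_curvature \<gamma> s =
     (THE k. vector_derivative (\<lambda>r. vector_derivative \<gamma> (at r)) (at s) = k *\<^sub>R unit_normal \<gamma> s)"

text \<open>The orientation of \<open>\<gamma>\<close> is the one for which the above normal points into the domain.\<close>

definition inward_oriented :: "(real^2) set \<Rightarrow> (real \<Rightarrow> real^2) \<Rightarrow> bool" where
  "inward_oriented \<Omega> \<gamma> \<longleftrightarrow>
     (\<forall>s. \<forall>\<^sub>F n in at_right 0. \<gamma> s + n *\<^sub>R unit_normal \<gamma> s \<in> \<Omega>)"

definition tubular_map :: "(real \<Rightarrow> real^2) \<Rightarrow> real \<times> real \<Rightarrow> real^2" where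
  "tubular_map \<gamma> = (\<lambda>(n, s). \<gamma> s + n *\<^sub>R unit_normal \<gamma> s)"

definition collar :: "(real^2) set \<Rightarrow> (real^2) set \<Rightarrow> real \<Rightarrow> (real^2) set" where
  "collar \<Omega> C \<delta> = {q \<in> \<Omega>. infdist q C < \<delta>}"

text \<open>The tubular map induces a smooth diffeomorphism from \<open>(0,\<delta>) \<times> \<real>/L\<int>\<close> onto the collar:
  it is smooth and bijective, and its inverse is smooth.  As the inverse takes values in
  \<open>(0,\<delta>) \<times> \<real>/L\<int>\<close>, its smoothness is that of its local lifts \<open>\<phi>\<close> to \<open>(0,\<delta>) \<times> \<real>\<close>.\<close>

definition tubular_chart ::
    "(real^2) set \<Rightarrow> (real^2) set \<Rightarrow> (real \<Rightarrow> real^2) \<Rightarrow> real \<Rightarrow> real \<Rightarrow> bool" where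
  "tubular_chart \<Omega> C \<gamma> L \<delta> \<longleftrightarrow>
     \<delta> > 0 \<and>
     smooth_on ({0<..<\<delta>} \<times> UNIV) (tubular_map \<gamma>) \<and>
     bij_betw (tubular_map \<gamma>) ({0<..<\<delta>} \<times> {0..<L}) (collar \<Omega> C \<delta>) \<and>
     (\<forall>q\<in>collar \<Omega> C \<delta>. \<exists>V \<phi>.
        open V \<and> q \<in> V \<and> smooth_on V \<phi> \<and>
        \<phi> ` V \<subseteq> {0<..<\<delta>} \<times> UNIV \<and> (\<forall>x\<in>V. tubular_map \<gamma> (\<phi> x) = x))"

definition tubular_field :: "(real^2 \<Rightarrow> real) \<Rightarrow> (real \<Rightarrow> real^2) \<Rightarrow> real \<Rightarrow> real \<Rightarrow> real" where
  "tubular_field b \<gamma> n s = - b (tubular_map \<gamma> (n, s)) * (1 - n * signed_curvature \<gamma> s)"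

section \<open>Dynamics\<close>

text \<open>Solutions of \<open>x' = X x\<close> staying in the phase space \<open>U\<close>, on a nonempty open time interval
  \<open>J\<close>.  Values of \<open>x\<close> outside \<open>J\<close> are irrelevant.\<close>

definition is_solution ::
    "('a::real_normed_vector \<Rightarrow> 'a) \<Rightarrow> 'a set \<Rightarrow> real set \<Rightarrow> (real \<Rightarrow> 'a) \<Rightarrow> bool" where
  "is_solution X U J x \<longleftrightarrow>
     open J \<and> is_interval J \<and> J \<noteq> {} \<and>
     (\<forall>t\<in>J. x t \<in> U \<and> (x has_vector_derivative X (x t)) (at t))"

definition is_maximal_solution ::
    "('a::real_normed_vector \<Rightarrow> 'a) \<Rightarrow> 'a set \<Rightarrow> real set \<Rightarrow> (real \<Rightarrow> 'a) \<Rightarrow> bool" where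
  "is_maximal_solution X U J x \<longleftrightarrow>
     is_solution X U J x \<and>
     (\<forall>J' y. is_solution X U J' y \<and> J \<subseteq> J' \<and> (\<forall>t\<in>J. y t = x t) \<longrightarrow> J' = J)"

definition complete_dynamics :: "('a::real_normed_vector \<Rightarrow> 'a) \<Rightarrow> 'a set \<Rightarrow> bool" where
  "complete_dynamics X U \<longleftrightarrow> (\<forall>J x. is_maximal_solution X U J x \<longrightarrow> J = UNIV)"

text \<open>Newton's equation \<open>q'' = b(q) (q\<^sub>2', -q\<^sub>1')\<close> as a first-order system in \<open>(q, q')\<close>.\<close>

definition newton_field :: "(real^2 \<Rightarrow> real) \<Rightarrow> (real^2) \<times> (real^2) \<Rightarrow> (real^2) \<times> (real^2)" where
  "newton_field b = (\<lambda>(q, v). (v, b q *\<^sub>R vector [v $ 2, - (v $ 1)]))"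

definition vector_potential :: "(real^2) set \<Rightarrow> (real^2 \<Rightarrow> real) \<Rightarrow> (real^2 \<Rightarrow> real^2) \<Rightarrow> bool" where
  "vector_potential \<Omega> b A \<longleftrightarrow>
     A differentiable_on \<Omega> \<and>
     (\<forall>q\<in>\<Omega>. frechet_derivative A (at q) (axis 1 1) $ 2
            - frechet_derivative A (at q) (axis 2 1) $ 1 = b q)"

definition magnetic_hamiltonian :: "(real^2 \<Rightarrow> real^2) \<Rightarrow> (real^2) \<times> (real^2) \<Rightarrow> real" where
  "magnetic_hamiltonian A = (\<lambda>(q, p). 1/2 * (norm (p - A q))\<^sup>2)"

definition hamiltonian_field ::
    "((real^2) \<times> (real^2) \<Rightarrow> real) \<Rightarrow> (real^2) \<times> (real^2) \<Rightarrow> (real^2) \<times> (real^2)" where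
  "hamiltonian_field H = (\<lambda>(q, p).
     (\<chi> i. frechet_derivative (\<lambda>p'. H (q, p')) (at p) (axis i 1),
      \<chi> i. - frechet_derivative (\<lambda>q'. H (q', p)) (at q) (axis i 1)))"

text \<open>The position converges to a boundary point as \<open>t\<close> tends, from within the time interval \<open>J\<close>,
  to a finite time (which may be either end of \<open>J\<close>).\<close>

definition reaches_boundary ::
    "(real^2) set \<Rightarrow> real set \<Rightarrow> (real \<Rightarrow> (real^2) \<times> (real^2)) \<Rightarrow> bool" where
  "reaches_boundary \<Omega> J x \<longleftrightarrow>
     (\<exists>T\<in>closure J. \<exists>z\<in>frontier \<Omega>. ((\<lambda>t. fst (x t)) \<longlongrightarrow> z) (at T within J))"

end

(* Near a boundary component the tubular coordinates (n, s) of a solution satisfy n = dist(q, C).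
   Writing T for the unit tangent and k for the curvature, the quantity

     G = (1 - n k(s)) (q' . T(s)) - F(n) / L,   F(n) = int_n^delta int_0^L B,

   has derivative -(B - mean of B) n' - n k'(s) s' (q' . T(s)), in which B only enters through its
   oscillation.  The speed is constant, so G' and the first term of G are bounded near the boundary.
   Hence F stays bounded along a solution in finite time, whereas |F(n)| tends to infinity as n
   tends to 0.  A solution that stays away from the boundary extends by Picard-Lindeloef, and
   (q, p) -> (q, p - A(q)) carries the Hamiltonian solutions to those of Newton's equation. *)
theory Submission
  imports Defs
begin

text \<open>Origin of G: in the coordinates (n, s) the field is the 2-form B dn ds, and the mean of
  B over s has the potential (-F(n) / L) ds. So G is the momentum conjugate to s in the averaged
  field, the analogue of the angular momentum that a rotationally symmetric field conserves; only
  the oscillation of B and the variation of k spoil its conservation.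

  Two obstacles shape the argument. The chart hypothesis does not state that n is the distance to C,
  and it yields s only through local lifts. The first is met near a boundary point: a nearest point
  of C is joined to q along the normal, and a local defining function decides that q lies on the
  inner side. The second is met by letting s enter only through L-periodic functions and by
  computing G' at one time after another.

  A vector potential is only assumed differentiable, so the Hamiltonian field may be discontinuous
  and Picard-Lindeloef does not apply to it. This is why completeness is transferred from Newton's
  equation.\<close>

section \<open>Local existence and continuation of solutions\<close>

text \<open>Picard iteration is a contraction of the complete space of bounded continuous functions
  on the line. Clamping the time by \<open>c\<close> makes every iterate constant outside the time
  interval, hence bounded.\<close>

lemma picard_global:
  fixes X :: "'a::euclidean_space \<Rightarrow> 'a"
  assumes lip: "K-lipschitz_on UNIV X"
  obtains h y where "h > 0" "y T = x0"
    "\<And>t. t \<in> ball T h \<Longrightarrow> (y has_vector_derivative X (y t)) (at t)"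
proof -
  have K: "K \<ge> 0" using lip by (rule lipschitz_on_nonneg)
  \<comment> \<open>Two iterates differ by at most \<open>3 * h * K\<close> times the distance of
    their arguments: \<open>2 * h\<close> comes from \<open>F\<close> at \<open>c t\<close> and
    \<open>h\<close> from \<open>F\<close> at \<open>T\<close>. The summand 1 covers
    \<open>K = 0\<close>.\<close>
  define h where "h = 1 / (6 * (K + 1))"
  have h: "h > 0" "3 * h * K \<le> 1/2" using K by (auto simp: h_def field_simps)
  define c where "c t = max (T - h) (min (T + h) t)" for t
  have c: "c t \<in> {T - h..T + h}" for t using h by (auto simp: c_def)
  have contc: "continuous_on UNIV c" unfolding c_def by (intro continuous_intros)
  have contX: "continuous_on A X" for A
    using lipschitz_on_continuous_on[OF lip] continuous_on_subset by blast
  have contXu: "continuous_on A (\<lambda>s. X (apply_bcontfun u s))" for A and u :: "real \<Rightarrow>\<^sub>C 'a"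
    by (rule continuous_on_compose2[OF contX[of UNIV]]) auto
  \<comment> \<open>The base point is \<open>T - h\<close> because \<open>integral {a..t}\<close>
    vanishes for t < a; subtracting \<open>F u T\<close> in \<open>P\<close> gives the integral from
    T in both time directions.\<close>
  define F where "F u t = integral {T - h..t} (\<lambda>s. X (apply_bcontfun u s))" for u t
  define P where "P u t = x0 + F u (c t) - F u T" for u t
  have contF: "continuous_on {T - h..T + h} (F u)" for u
    unfolding F_def by (rule indefinite_integral_continuous_1) (intro integrable_continuous_real contXu)
  have contP: "continuous_on UNIV (P u)" for u
    unfolding P_def by (intro continuous_intros continuous_on_compose2[OF contF contc]) (use c in auto)
  have bcP: "P u \<in> bcontfun" for u
  proof -
    have "bounded (F u ` {T - h..T + h})"
      by (intro compact_imp_bounded compact_continuous_image contF compact_Icc)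
    then obtain B where "\<forall>x\<in>F u ` {T - h..T + h}. norm x \<le> B"
      unfolding bounded_iff by blast
    then have B: "norm (F u t) \<le> B" if "t \<in> {T - h..T + h}" for t
      using that by blast
    have "norm (P u t) \<le> norm x0 + B + norm (F u T)" for t
      unfolding P_def using B[OF c[of t]] norm_triangle_ineq[of x0 "F u (c t)"]
        norm_triangle_ineq4[of "x0 + F u (c t)" "F u T"] by linarith
    then show ?thesis using contP by (intro bcontfun_normI)
  qed
  define Q where "Q u = Bcontfun (P u)" for u
  have Q: "apply_bcontfun (Q u) = P u" for u
    unfolding Q_def using bcP by (rule Bcontfun_inverse)
  have Fdiff: "dist (F u t) (F v t) \<le> (t - (T - h)) * (K * dist u v)" if t: "t \<in> {T - h..T + h}" for u v t
  proof -
    have "F u t - F v t = integral {T - h..t} (\<lambda>s. X (apply_bcontfun u s) - X (apply_bcontfun v s))"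
      unfolding F_def by (rule Henstock_Kurzweil_Integration.integral_diff[symmetric]; intro integrable_continuous_real contXu)
    also have "norm \<dots> \<le> (K * dist u v) * (t - (T - h))"
    proof (rule integral_bound)
      show "T - h \<le> t" using t by auto
      show "continuous_on {T - h..t} (\<lambda>s. X (apply_bcontfun u s) - X (apply_bcontfun v s))"
        by (intro continuous_intros contXu)
      fix s
      have "dist (X (apply_bcontfun u s)) (X (apply_bcontfun v s)) \<le> K * dist (apply_bcontfun u s) (apply_bcontfun v s)"
        by (rule lipschitz_onD[OF lip]) auto
      also have "\<dots> \<le> K * dist u v" using K dist_bounded by (intro mult_left_mono) auto
      finally show "norm (X (apply_bcontfun u s) - X (apply_bcontfun v s)) \<le> K * dist u v"
        by (simp add: dist_norm)
    qed
    finally show ?thesis by (simp add: dist_norm mult.commute)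
  qed
  have "dist (Q u) (Q v) \<le> 1/2 * dist u v" for u v
  proof (rule dist_bound)
    fix t
    have "norm (P u t - P v t) \<le> norm (F u (c t) - F v (c t)) + norm (F u T - F v T)"
      unfolding P_def by (rule order_trans[OF _ norm_triangle_ineq4]) (simp add: algebra_simps)
    also have "\<dots> \<le> (c t - (T - h)) * (K * dist u v) + (T - (T - h)) * (K * dist u v)"
      using Fdiff[OF c[of t], of u v] Fdiff[of T u v] h by (simp add: dist_norm)
    also have "\<dots> \<le> (2 * h) * (K * dist u v) + h * (K * dist u v)"
      using c[of t] K by (intro add_mono mult_right_mono) auto
    also have "\<dots> = (3 * h * K) * dist u v" by (simp add: algebra_simps)
    also have "\<dots> \<le> 1/2 * dist u v" using h by (intro mult_right_mono) auto
    finally show "dist (apply_bcontfun (Q u) t) (apply_bcontfun (Q v) t) \<le> 1/2 * dist u v"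
      by (simp add: Q dist_norm)
  qed
  then have "\<exists>!u. Q u = u"
    by (intro banach_fix_type[of "1/2"]) auto
  then obtain u where u: "Q u = u" by blast
  define y where "y = apply_bcontfun u"
  have y: "y t = x0 + F u (c t) - F u T" for t
    using Q[of u] u by (simp add: y_def P_def)
  show ?thesis
  proof
    show "h > 0" by fact
    show "y T = x0" using h by (simp add: y c_def)
    fix t assume t: "t \<in> ball T h"
    then have t': "t \<in> {T - h<..<T + h}" by (auto simp: dist_real_def)
    have "(F u has_vector_derivative X (y t)) (at t within {T - h..T + h})"
      unfolding F_def y_def using t' by (intro integral_has_vector_derivative contXu) auto
    then have "(F u has_vector_derivative X (y t)) (at t within {T - h<..<T + h})"
      by (rule has_vector_derivative_within_subset) auto
    then have "(F u has_vector_derivative X (y t)) (at t)"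
      by (simp only: at_within_open[OF t' open_greaterThanLessThan])
    then have "((\<lambda>t. x0 + F u t - F u T) has_vector_derivative X (y t)) (at t)"
      by (auto intro!: derivative_eq_intros)
    then show "(y has_vector_derivative X (y t)) (at t)"
      by (rule has_vector_derivative_transform_within_open[where S = "{T - h<..<T + h}"])
        (use t' in \<open>auto simp: y c_def\<close>)
  qed
qed

text \<open>The projection onto a small closed ball is 1-Lipschitz, so X composed with it is
  globally Lipschitz. By continuity the solution of the modified equation stays in the ball for a
  short time, and there both fields agree.\<close>

lemma local_solution_exists:
  fixes X :: "'a::euclidean_space \<Rightarrow> 'a"
  assumes lip: "local_lipschitz (UNIV :: real set) U (\<lambda>_. X)" and U: "open U" "x0 \<in> U"
  obtains h y where "h > 0" "y T = x0" "is_solution X U (ball T h) y"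
proof -
  obtain r1 K where r1: "r1 > 0" "K-lipschitz_on (cball x0 r1 \<inter> U) X"
  proof (rule local_lipschitzE[OF lip UNIV_I U(2), of 0])
    fix r K assume "r > 0" "\<And>s. s \<in> cball 0 r \<inter> UNIV \<Longrightarrow> K-lipschitz_on (cball x0 r \<inter> U) X"
    moreover from this(2)[of 0] \<open>r > 0\<close> have "K-lipschitz_on (cball x0 r \<inter> U) X" by simp
    ultimately show ?thesis using that[of r K] by blast
  qed
  obtain r2 where r2: "r2 > 0" "cball x0 r2 \<subseteq> U"
    using U open_contains_cball by blast
  define r where "r = min r1 r2"
  let ?B = "cball x0 r"
  have r: "r > 0" "?B \<subseteq> U" using r1 r2 by (auto simp: r_def)
  have "K-lipschitz_on ?B X"
    by (rule lipschitz_on_subset[OF r1(2)]) (use r2 in \<open>auto simp: r_def\<close>)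
  then have "K-lipschitz_on (range (closest_point ?B)) X"
    by (rule lipschitz_on_subset) (use r(1) closest_point_in_set[of ?B] in auto)
  moreover have "1-lipschitz_on UNIV (closest_point ?B)"
    using r(1) closest_point_lipschitz[of ?B] by (intro lipschitz_onI) auto
  ultimately have "(K * 1)-lipschitz_on UNIV (X \<circ> closest_point ?B)"
    by (intro lipschitz_on_compose)
  then obtain h y where hy: "h > 0" "y T = x0"
    "\<And>t. t \<in> ball T h \<Longrightarrow> (y has_vector_derivative (X \<circ> closest_point ?B) (y t)) (at t)"
    by (rule picard_global) blast
  have "isCont y T"
    using hy(1) hy(3)[of T] has_vector_derivative_continuous by fastforce
  then obtain d where d: "d > 0" "\<And>t. dist t T < d \<Longrightarrow> dist (y t) x0 < r"
    using r(1) hy(2) unfolding continuous_at_eps_delta by blast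
  show ?thesis
  proof
    show "min h d > 0" using hy d by auto
    show "y T = x0" by fact
    show "is_solution X U (ball T (min h d)) y"
      unfolding is_solution_def
    proof (intro conjI ballI)
      show "is_interval (ball T (min h d))" by (simp add: is_interval_convex_1)
      show "ball T (min h d) \<noteq> {}" using hy d by auto
      fix t assume t: "t \<in> ball T (min h d)"
      then have yB: "y t \<in> ?B" using d(2)[of t] by (auto simp: dist_commute)
      then show "y t \<in> U" using r by auto
      show "(y has_vector_derivative X (y t)) (at t)"
        using hy(3)[of t] t closest_point_self[OF yB] by simp
    qed auto
  qed
qed

text \<open>The fundamental theorem of calculus tolerates one exceptional point, so u is an
  indefinite integral of f near T. This yields the equation at the time where two solutions are
  glued.\<close>

lemma has_vector_derivative_at_removable:
  fixes u :: "real \<Rightarrow> 'a::euclidean_space"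
  assumes e: "e > 0" and cont: "\<And>t. t \<in> ball T e \<Longrightarrow> isCont u t"
    and der: "\<And>t. t \<in> ball T e - {T} \<Longrightarrow> (u has_vector_derivative f t) (at t)"
    and f: "continuous_on (ball T e) f"
  shows "(u has_vector_derivative f T) (at T)"
proof -
  define a where "a = T - e/2"
  define b where "b = T + e/2"
  have ab: "T \<in> {a<..<b}" "{a..b} \<subseteq> ball T e" using e by (auto simp: a_def b_def dist_real_def)
  have eq: "integral {a..t} f = u t - u a" if "t \<in> {a..b}" for t
  proof (rule integral_unique, rule fundamental_theorem_of_calculus_interior_strong[where S = "{T}"])
    show "continuous_on {a..t} u"
      by (intro continuous_at_imp_continuous_on ballI cont) (use that ab(2) in force)
    fix x assume "x \<in> {a<..<t} - {T}"
    then show "(u has_vector_derivative f x) (at x)"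
      using that subsetD[OF ab(2), of x] by (intro der) auto
  qed (use that in auto)
  have "((\<lambda>t. integral {a..t} f) has_vector_derivative f T) (at T within {a..b})"
    using ab by (intro integral_has_vector_derivative continuous_on_subset[OF f]) auto
  then have "((\<lambda>t. integral {a..t} f) has_vector_derivative f T) (at T within {a<..<b})"
    by (rule has_vector_derivative_within_subset) auto
  then have "((\<lambda>t. integral {a..t} f) has_vector_derivative f T) (at T)"
    by (simp only: at_within_open[OF ab(1) open_greaterThanLessThan])
  then have "((\<lambda>t. integral {a..t} f + u a) has_vector_derivative f T) (at T)"
    by (auto intro!: derivative_eq_intros)
  then show ?thesis
    by (rule has_vector_derivative_transform_within_open[where S = "{a<..<b}"])
      (use ab eq in auto)
qed

text \<open>The continuation is a local solution started at the limit \<open>x0\<close> at time T.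
  The glued function is continuous at T and solves the equation on both sides, so T is a removable
  point.\<close>

lemma solution_extends:
  fixes X :: "'a::euclidean_space \<Rightarrow> 'a"
  assumes lip: "local_lipschitz (UNIV :: real set) U (\<lambda>_. X)" and U: "open U"
    and sol: "is_solution X U J x"
    and T: "T \<in> closure J" "T \<notin> J"
    and lim: "(x \<longlongrightarrow> x0) (at T within J)" and x0: "x0 \<in> U"
  obtains J' y where "is_solution X U J' y" "J \<subset> J'" "\<And>t. t \<in> J \<Longrightarrow> y t = x t"
proof -
  have J: "open J" "is_interval J" "J \<noteq> {}"
    and x: "\<And>t. t \<in> J \<Longrightarrow> x t \<in> U" "\<And>t. t \<in> J \<Longrightarrow> (x has_vector_derivative X (x t)) (at t)"
    using sol by (auto simp: is_solution_def)
  obtain h y where h: "h > 0" "y T = x0" "is_solution X U (ball T h) y"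
    using local_solution_exists[OF lip U x0] by blast
  have y: "\<And>t. t \<in> ball T h \<Longrightarrow> y t \<in> U" "\<And>t. t \<in> ball T h \<Longrightarrow> (y has_vector_derivative X (y t)) (at t)"
    using h by (auto simp: is_solution_def)
  obtain t0 where t0: "t0 \<in> J" using J by blast
  \<comment> \<open>At most the distance to \<open>t0\<close>: on the side of \<open>t0\<close> the
    ball then lies in J, on the other side it misses J, and the other end of J is out of
    reach.\<close>
  define e where "e = min h (dist t0 T)"
  have e: "e > 0" using h t0 T by (auto simp: e_def)
  let ?B = "ball T e"
  \<comment> \<open>A time off the closure of J has a whole neighbourhood on which the glued
    function is \<open>y\<close>.\<close>
  have clJ: "t \<notin> closure J" if t: "t \<in> ?B" "t \<notin> J" "t \<noteq> T" for t
  proof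
    assume "t \<in> closure J"
    have cv: "convex J" using J by (simp add: is_interval_convex_1)
    have "t0 \<in> interior J" using t0 J by (simp add: interior_open)
    then have "open_segment t0 t \<subseteq> J" "open_segment t0 T \<subseteq> J"
      using in_interior_closure_convex_segment[OF cv _ \<open>t \<in> closure J\<close>]
        in_interior_closure_convex_segment[OF cv _ T(1)] J by (auto simp: interior_open)
    then have "t \<notin> open_segment t0 T" "T \<notin> open_segment t0 t"
      using t T by auto
    then show False using t t0 T
      by (auto simp: open_segment_eq_real_ivl e_def dist_real_def split: if_splits)
  qed
  define u where "u t = (if t \<in> J then x t else y t)" for t
  have uU: "u t \<in> U" if "t \<in> J \<union> ?B" for t
    using that x y by (auto simp: u_def e_def)
  have uJ: "(u has_vector_derivative X (u t)) (at t)" if t: "t \<in> J" for t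
    using has_vector_derivative_transform_within_open[OF x(2)[OF t] J(1) t, of u] t by (simp add: u_def)
  have uB: "(u has_vector_derivative X (u t)) (at t)" if t: "t \<in> ?B - {T}" for t
  proof (cases "t \<in> J")
    case False
    have o: "open (?B - closure J)" by auto
    have tB: "t \<in> ?B - closure J" using clJ t False by auto
    have yt: "(y has_vector_derivative X (y t)) (at t)" using y t by (auto simp: e_def)
    have "y s = u s" if "s \<in> ?B - closure J" for s
      using that closure_subset[of J] by (auto simp: u_def)
    then show ?thesis
      using has_vector_derivative_transform_within_open[OF yt o tB, of u] False by (simp add: u_def)
  qed (rule uJ)
  have uT: "u T = x0" using T h by (simp add: u_def)
  have "(u \<longlongrightarrow> x0) (at T within (J \<union> - J))"
  proof (subst at_within_union, rule filterlim_sup)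
    show "(u \<longlongrightarrow> x0) (at T within J)"
      by (rule Lim_transform_eventually[OF lim]) (auto simp: u_def eventually_at_filter)
    have "isCont y T"
      using y(2)[of T] h(1) has_vector_derivative_continuous by fastforce
    then have "(y \<longlongrightarrow> x0) (at T within - J)"
      using h(2) by (auto simp: isCont_def intro: tendsto_within_subset)
    then show "(u \<longlongrightarrow> x0) (at T within - J)"
      by (rule Lim_transform_eventually) (auto simp: u_def eventually_at_filter)
  qed
  then have contT: "isCont u T" by (simp add: isCont_def uT)
  have contu: "isCont u t" if "t \<in> ?B" for t
    using contT uB[of t] that has_vector_derivative_continuous[of u "X (u t)" t UNIV] by (cases "t = T") auto
  have "continuous_on ?B (\<lambda>t. X (u t))"
  proof (rule continuous_on_compose2[where g = X and f = u and t = U])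
    show "continuous_on U X" using local_lipschitz_continuous_on[OF lip UNIV_I] .
    show "continuous_on ?B u" using contu by (intro continuous_at_imp_continuous_on ballI)
  qed (use uU in blast)
  then have "(u has_vector_derivative X (u T)) (at T)"
    using has_vector_derivative_at_removable[OF e contu, where f = "\<lambda>t. X (u t)"] uB by auto
  then have uB': "(u has_vector_derivative X (u t)) (at t)" if "t \<in> ?B" for t
    using uB that by (cases "t = T") auto
  show ?thesis
  proof (rule that[of "J \<union> ?B" u])
    show "J \<subset> J \<union> ?B" using T(2) centre_in_ball[of T e] e by blast
    show "is_solution X U (J \<union> ?B) u"
      unfolding is_solution_def
    proof (intro conjI ballI)
      obtain t1 where "t1 \<in> J" "dist t1 T < e" using T(1) e closure_approachable by blast
      then have "J \<inter> ?B \<noteq> {}" by (auto simp: dist_commute)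
      then show "is_interval (J \<union> ?B)"
        using J by (auto simp: is_interval_connected_1 intro!: connected_Un)
    qed (use J uU uJ uB' in auto)
  qed (simp add: u_def)
qed

section \<open>Arc-length parametrized closed curves\<close>

lemma Ck_on_vector_derivative:
  assumes "Ck_on (Suc k) g (UNIV :: real set)"
  shows "(g has_vector_derivative vector_derivative g (at s)) (at s)"
    and "Ck_on k (\<lambda>s. vector_derivative g (at s)) UNIV"
proof -
  have d: "g differentiable at s" for s
    using assms by (simp add: differentiable_on_def)
  then show vd: "(g has_vector_derivative vector_derivative g (at s)) (at s)" for s
    by (simp add: vector_derivative_works)
  have "(\<lambda>s. vector_derivative g (at s)) = (\<lambda>s. frechet_derivative g (at s) 1)"
    by (rule ext) (metis frechet_derivative_at has_vector_derivative_def scaleR_one vd)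
  then show "Ck_on k (\<lambda>s. vector_derivative g (at s)) UNIV"
    using assms by simp
qed

lemma smooth_on_vector_derivative:
  assumes "smooth_on (UNIV :: real set) g"
  shows "(g has_vector_derivative vector_derivative g (at s)) (at s)"
    and "smooth_on UNIV (\<lambda>s. vector_derivative g (at s))"
  using assms Ck_on_vector_derivative[of _ g] unfolding smooth_on_def by blast+

lemma has_vector_derivative_shift:
  fixes s L :: real
  assumes "(f has_vector_derivative D) (at (s + L))"
  shows "((\<lambda>s. f (s + L)) has_vector_derivative D) (at s)"
proof -
  have "((\<lambda>s. s + L) has_vector_derivative 1) (at s)"
    by (auto intro!: derivative_eq_intros)
  from vector_diff_chain_at[OF this assms] show ?thesis by (simp add: o_def)
qed

lemma periodic_shift:
  fixes f :: "real \<Rightarrow> 'a"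
  assumes "\<And>s. f (s + L) = f s"
  shows "f (s + of_int k * L) = f s"
proof (induction k rule: int_induct[where k = 0])
  case (step1 i)
  then show ?case using assms[of "s + of_int i * L"] by (simp add: algebra_simps)
next
  case (step2 i)
  then show ?case using assms[of "s + of_int (i - 1) * L"] by (simp add: algebra_simps)
qed simp

text \<open>The chart is injective on the fundamental domain \<open>{0..<L}\<close> only, whereas
  coordinates along a motion take values in the whole line; this representative modulo L mediates
  between the two.\<close>

definition circle_rep :: "real \<Rightarrow> real \<Rightarrow> real" where
  "circle_rep L s = s + of_int (- \<lfloor>s / L\<rfloor>) * L"

lemma circle_rep_mem:
  assumes "L > 0"
  shows "circle_rep L s \<in> {0..<L}"
  using floor_divide_lower[OF assms, of s] floor_divide_upper[OF assms, of s]
  by (simp add: circle_rep_def algebra_simps)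

lemma periodic_circle_rep:
  assumes "\<And>s. f (s + L) = f s"
  shows "f (circle_rep L s) = f s"
  unfolding circle_rep_def by (rule periodic_shift[where f = f and L = L]) (rule assms)

lemma periodic_continuous_bounded:
  fixes f :: "real \<Rightarrow> 'a::real_normed_vector"
  assumes L: "L > 0" and per: "\<And>s. f (s + L) = f s" and cont: "continuous_on UNIV f"
  obtains K where "\<And>s. norm (f s) \<le> K"
proof -
  have "bounded (f ` {0..L})"
    by (intro compact_imp_bounded compact_continuous_image continuous_on_subset[OF cont] compact_Icc) auto
  then obtain K where "\<forall>x\<in>f ` {0..L}. norm x \<le> K"
    unfolding bounded_iff by blast
  then have K: "norm (f x) \<le> K" if "x \<in> {0..L}" for x
    using that by blast
  have "norm (f s) \<le> K" for s
  proof -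
    have "circle_rep L s \<in> {0..L}"
      using circle_rep_mem[OF L, of s] by auto
    then show ?thesis
      using K[of "circle_rep L s"] periodic_circle_rep[where f = f and L = L and s = s] per by simp
  qed
  then show ?thesis using that by blast
qed

section \<open>The quarter turn of the plane, which produces both the normal and the magnetic
  force\<close>

definition perp :: "real^2 \<Rightarrow> real^2" where
  "perp v = vector [- (v $ 2), v $ 1]"

lemma perp_nth [simp]: "perp v $ 1 = - (v $ 2)" "perp v $ 2 = v $ 1"
  by (simp_all add: perp_def)

lemma inner_2: "(u :: real^2) \<bullet> v = u $ 1 * v $ 1 + u $ 2 * v $ 2"
  by (simp add: inner_vec_def sum_2)

lemma vec_eq_2: "(u :: real^2) = v \<longleftrightarrow> u $ 1 = v $ 1 \<and> u $ 2 = v $ 2"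
  by (simp add: vec_eq_iff forall_2)

lemma bounded_linear_perp: "bounded_linear perp"
  by (rule linear_conv_bounded_linear[THEN iffD1], rule linearI) (simp_all add: vec_eq_2)

lemma perp_perp [simp]: "perp (perp v) = - v"
  by (simp add: vec_eq_2)

lemma inner_perp_self [simp]: "v \<bullet> perp v = 0" "perp v \<bullet> v = 0"
  by (simp_all add: inner_2)

lemma inner_perp_perp [simp]: "perp u \<bullet> perp v = u \<bullet> v"
  by (simp add: inner_2)

lemma inner_perp_swap: "perp u \<bullet> v = - (u \<bullet> perp v)"
  by (simp add: inner_2)

lemma norm_perp [simp]: "norm (perp v) = norm v"
  by (simp add: norm_eq_sqrt_inner)

lemma perp_decomposition:
  assumes "norm e = 1"
  shows "v = (v \<bullet> e) *\<^sub>R e + (v \<bullet> perp e) *\<^sub>R perp e"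
proof -
  have "e \<bullet> e = 1" using assms by (simp add: norm_eq_1)
  then have *: "(e$1)\<^sup>2 + (e$2)\<^sup>2 = 1" by (simp add: inner_2 power2_eq_square)
  have "v $ i = v $ i * ((e$1)\<^sup>2 + (e$2)\<^sup>2)" for i using * by simp
  from this[of 1] this[of 2] show ?thesis
    unfolding vec_eq_2 inner_2 by (simp add: power2_eq_square algebra_simps)
qed

lemma unit_normal_eq: "unit_normal g s = perp (vector_derivative g (at s))"
  by (simp add: unit_normal_def perp_def Let_def)

lemma newton_field_eq: "newton_field b (q, v) = (v, - (b q *\<^sub>R perp v))"
  by (simp add: newton_field_def vec_eq_2)

section \<open>The Frenet frame and bounds on the curvature\<close>

locale arclength_curve =
  fixes \<gamma> :: "real \<Rightarrow> real^2" and L :: real and C :: "(real^2) set"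
  assumes arclength: "arclength_parametrization \<gamma> L C"
begin

definition tangent :: "real \<Rightarrow> real^2" where
  "tangent s = vector_derivative \<gamma> (at s)"

abbreviation normal :: "real \<Rightarrow> real^2" where
  "normal \<equiv> unit_normal \<gamma>"

abbreviation curvature :: "real \<Rightarrow> real" where
  "curvature \<equiv> signed_curvature \<gamma>"

lemma L_pos: "L > 0" and periodic: "\<gamma> (s + L) = \<gamma> s"
  and range_eq: "range \<gamma> = C"
  and norm_tangent [simp]: "norm (tangent s) = 1"
  using arclength by (auto simp: arclength_parametrization_def tangent_def)

lemma smooth: "smooth_on UNIV \<gamma>"
  using arclength by (auto simp: arclength_parametrization_def)

lemma normal_eq: "normal s = perp (tangent s)"
  by (simp add: unit_normal_eq tangent_def)

lemma norm_normal [simp]: "norm (normal s) = 1"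
  by (simp add: normal_eq)

lemma normal_nonzero [simp]: "normal s \<noteq> 0"
  using norm_normal[of s] by force

lemma frame_inner [simp]:
  "tangent s \<bullet> tangent s = 1" "normal s \<bullet> normal s = 1"
  "tangent s \<bullet> normal s = 0" "normal s \<bullet> tangent s = 0"
  by (simp_all add: normal_eq flip: norm_eq_1)

lemma perp_tangent: "perp (tangent s) = normal s" and perp_normal: "perp (normal s) = - tangent s"
  by (simp_all add: normal_eq)

lemma frame_decomposition: "v = (v \<bullet> tangent s) *\<^sub>R tangent s + (v \<bullet> normal s) *\<^sub>R normal s"
  unfolding normal_eq by (rule perp_decomposition) simp

lemma smooth_tangent: "smooth_on UNIV tangent"
  and has_vector_derivative_curve: "(\<gamma> has_vector_derivative tangent s) (at s)"
  using smooth_on_vector_derivative[OF smooth] unfolding tangent_def[abs_def] by auto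

text \<open>Differentiating T . T = 1 shows that T' is orthogonal to T, hence a multiple of the
  nonzero normal. The multiple is unique, so the definite description in
  \<open>signed_curvature\<close> denotes it.\<close>

lemma has_vector_derivative_tangent:
  "(tangent has_vector_derivative curvature s *\<^sub>R normal s) (at s)"
proof -
  let ?T' = "vector_derivative tangent (at s)"
  have T': "(tangent has_vector_derivative ?T') (at s)"
    by (rule smooth_on_vector_derivative(1)[OF smooth_tangent])
  have "((\<lambda>s. tangent s \<bullet> tangent s) has_vector_derivative (tangent s \<bullet> ?T' + ?T' \<bullet> tangent s)) (at s)"
    using bounded_bilinear.has_vector_derivative[OF bounded_bilinear_inner T' T'] .
  then have "((\<lambda>s. 1 :: real) has_vector_derivative (tangent s \<bullet> ?T' + ?T' \<bullet> tangent s)) (at s)"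
    by simp
  then have "tangent s \<bullet> ?T' + ?T' \<bullet> tangent s = 0"
    using vector_derivative_unique_at has_vector_derivative_const by blast
  then have "?T' \<bullet> tangent s = 0" by (simp add: inner_commute)
  then have eq: "?T' = (?T' \<bullet> normal s) *\<^sub>R normal s"
    using frame_decomposition[of ?T' s] by simp
  have "k = ?T' \<bullet> normal s" if "?T' = k *\<^sub>R normal s" for k
    using that by simp
  then have "curvature s = ?T' \<bullet> normal s"
    unfolding signed_curvature_def tangent_def[symmetric] using eq by (intro the_equality) auto
  then show ?thesis using T' eq by simp
qed

text \<open>The second Frenet equation is the quarter turn of the first, as this turn maps N to
  -T.\<close>

lemma has_vector_derivative_normal:
  "(normal has_vector_derivative - (curvature s *\<^sub>R tangent s)) (at s)"
proof -
  have "((\<lambda>s. perp (tangent s)) has_vector_derivative perp (curvature s *\<^sub>R normal s)) (at s)"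
    by (rule bounded_linear.has_vector_derivative[OF bounded_linear_perp has_vector_derivative_tangent])
  moreover have "perp (curvature s *\<^sub>R normal s) = - (curvature s *\<^sub>R tangent s)"
    by (simp add: linear_scale[OF bounded_linear.linear[OF bounded_linear_perp]] perp_normal)
  ultimately show ?thesis by (simp add: perp_tangent)
qed

lemma curvature_eq: "curvature s = vector_derivative tangent (at s) \<bullet> normal s"
  using vector_derivative_at[OF has_vector_derivative_tangent[of s]] by simp

lemma tangent_periodic: "tangent (s + L) = tangent s"
proof -
  have "((\<lambda>s. \<gamma> (s + L)) has_vector_derivative tangent (s + L)) (at s)"
    by (rule has_vector_derivative_shift[OF has_vector_derivative_curve])
  then show ?thesis
    using has_vector_derivative_curve[of s] by (simp add: periodic vector_derivative_unique_at)
qed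

lemma normal_periodic: "normal (s + L) = normal s"
  by (simp add: normal_eq tangent_periodic)

lemma curvature_periodic: "curvature (s + L) = curvature s"
proof -
  have "((\<lambda>s. tangent (s + L)) has_vector_derivative curvature (s + L) *\<^sub>R normal (s + L)) (at s)"
    by (rule has_vector_derivative_shift[OF has_vector_derivative_tangent])
  then have "curvature (s + L) *\<^sub>R normal (s + L) = curvature s *\<^sub>R normal s"
    using has_vector_derivative_tangent[of s] by (simp add: tangent_periodic vector_derivative_unique_at)
  then show ?thesis by (simp add: normal_periodic)
qed

text \<open>The curvature is T' . N, so the product rule gives its derivative. Continuity and
  periodicity of the derivative are recorded because together they bound it.\<close>

lemma curvature_C1:
  obtains k' where "\<And>s. (curvature has_real_derivative k' s) (at s)"
    "continuous_on UNIV k'" "\<And>s. k' (s + L) = k' s"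
proof -
  define T' where "T' s = vector_derivative tangent (at s)" for s
  define T'' where "T'' s = vector_derivative T' (at s)" for s
  have s1: "smooth_on UNIV T'"
    using smooth_on_vector_derivative(2)[OF smooth_tangent] by (simp add: T'_def[abs_def])
  have d2: "(T' has_vector_derivative T'' s) (at s)" for s
    unfolding T''_def by (rule smooth_on_vector_derivative(1)[OF s1])
  have c2: "continuous_on UNIV T''"
    using smooth_on_vector_derivative(2)[OF s1] unfolding T''_def[abs_def] smooth_on_def
    by (metis Ck_on.simps(1))
  define k' where "k' s = T' s \<bullet> - (curvature s *\<^sub>R tangent s) + T'' s \<bullet> normal s" for s
  have k: "curvature = (\<lambda>s. T' s \<bullet> normal s)"
    by (rule ext) (simp add: curvature_eq T'_def)
  have dk: "(curvature has_real_derivative k' s) (at s)" for s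
    unfolding k'_def has_real_derivative_iff_has_vector_derivative
    by (subst k) (rule bounded_bilinear.has_vector_derivative[OF bounded_bilinear_inner d2 has_vector_derivative_normal])
  have cont: "continuous_on UNIV T'" "continuous_on UNIV curvature" "continuous_on UNIV tangent" "continuous_on UNIV normal"
    using has_vector_derivative_continuous[OF d2] DERIV_isCont[OF dk]
      has_vector_derivative_continuous[OF has_vector_derivative_tangent]
      has_vector_derivative_continuous[OF has_vector_derivative_normal]
    by (simp_all add: continuous_at_imp_continuous_on)
  show ?thesis
  proof (rule that)
    show "(curvature has_real_derivative k' s) (at s)" for s by (rule dk)
    show "continuous_on UNIV k'"
      unfolding k'_def by (intro continuous_intros cont c2)
    show "k' (s + L) = k' s" for s
    proof -
      have "((\<lambda>s. curvature (s + L)) has_real_derivative k' (s + L)) (at s)"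
        using DERIV_shift[of curvature] dk by blast
      then show ?thesis using dk[of s] by (simp add: curvature_periodic DERIV_unique)
    qed
  qed
qed

lemma curvature_bounds:
  obtains K k' where "K > 0" "\<And>s. \<bar>curvature s\<bar> \<le> K"
    "\<And>s. (curvature has_real_derivative k' s) (at s)" "\<And>s. \<bar>k' s\<bar> \<le> K"
proof -
  obtain k' where k': "\<And>s. (curvature has_real_derivative k' s) (at s)"
    "continuous_on UNIV k'" "\<And>s. k' (s + L) = k' s" using curvature_C1 by blast
  have "continuous_on UNIV curvature"
    using k'(1) by (auto intro!: continuous_at_imp_continuous_on DERIV_isCont)
  then obtain K1 where K1: "\<And>s. norm (curvature s) \<le> K1"
    using periodic_continuous_bounded[where f = curvature] L_pos curvature_periodic by metis
  obtain K2 where K2: "\<And>s. norm (k' s) \<le> K2"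
    using periodic_continuous_bounded[where f = k'] L_pos k'(2,3) by metis
  show ?thesis
  \<comment> \<open>The 1 makes the bound positive, since a distance to the boundary is later
    compared with 1 / (2 K).\<close>
  proof (rule that[of "max 1 (max K1 K2)" k'])
    show "\<bar>curvature s\<bar> \<le> max 1 (max K1 K2)" "\<bar>k' s\<bar> \<le> max 1 (max K1 K2)" for s
      using K1[of s] K2[of s] by auto
  qed (use k' in auto)
qed

end

section \<open>Tubular coordinates near the boundary\<close>

text \<open>\<open>Ck_on\<close> speaks of directional derivatives one at a time. Collecting the
  partial derivatives into a vector turns this into a continuous gradient field, which can be
  estimated uniformly near a point.\<close>

lemma smooth_real_gradient:
  fixes \<rho> :: "real^2 \<Rightarrow> real"
  assumes "open U" "smooth_on U \<rho>"
    and nz: "\<And>x. x \<in> U \<Longrightarrow> frechet_derivative \<rho> (at x) \<noteq> (\<lambda>_. 0)"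
  obtains g where "\<And>x. x \<in> U \<Longrightarrow> (\<rho> has_derivative (\<lambda>v. g x \<bullet> v)) (at x)"
    "continuous_on U g" "\<And>x. x \<in> U \<Longrightarrow> g x \<noteq> 0"
proof -
  let ?D = "\<lambda>x. frechet_derivative \<rho> (at x)"
  define g where "g x = (\<Sum>i\<in>Basis. ?D x i *\<^sub>R i)" for x
  have ck: "Ck_on (Suc 0) \<rho> U" using assms by (auto simp: smooth_on_def)
  have D: "(\<rho> has_derivative ?D x) (at x)" if "x \<in> U" for x
    using ck that \<open>open U\<close> by (auto simp: differentiable_on_eq_differentiable_at frechet_derivative_works)
  have Dg: "?D x = (\<lambda>v. g x \<bullet> v)" if "x \<in> U" for x
  proof
    fix v
    interpret linear "?D x" using D[OF that] by (rule has_derivative_linear)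
    have "?D x v = ?D x (\<Sum>i\<in>Basis. (v \<bullet> i) *\<^sub>R i)" by (simp add: euclidean_representation)
    also have "\<dots> = g x \<bullet> v"
      unfolding sum scale g_def by (simp add: inner_sum_left inner_commute[of v] mult.commute)
    finally show "?D x v = g x \<bullet> v" .
  qed
  show ?thesis
  proof (rule that)
    show "(\<rho> has_derivative (\<lambda>v. g x \<bullet> v)) (at x)" if "x \<in> U" for x
      using D[OF that] Dg[OF that] by simp
    show "continuous_on U g"
      unfolding g_def using ck by (intro continuous_intros) auto
    show "g x \<noteq> 0" if "x \<in> U" for x
      using nz[OF that] Dg[OF that] by auto
  qed
qed

locale tubular_neighborhood = arclength_curve +
  fixes \<Omega> :: "(real^2) set" and \<delta> :: real
  assumes domain: "smooth_bounded_domain \<Omega>"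
    and component: "C \<in> components (frontier \<Omega>)"
    and inward: "inward_oriented \<Omega> \<gamma>"
    and chart: "tubular_chart \<Omega> C \<gamma> L \<delta>"
begin

lemma open_domain: "open \<Omega>"
  using domain by (simp add: smooth_bounded_domain_def)

lemma C_subset_frontier: "C \<subseteq> frontier \<Omega>"
  using component by (rule in_components_subset)

lemma C_nonempty: "C \<noteq> {}"
  using component by (rule in_components_nonempty)

lemma C_closed: "closed C"
  using component frontier_closed by (rule closed_components[rotated])

lemma curve_in_C [simp]: "\<gamma> s \<in> C"
  using range_eq by auto

lemma C_disjoint: "c \<in> C \<Longrightarrow> c \<notin> \<Omega>"
  using C_subset_frontier open_domain by (auto simp: frontier_def interior_open)

text \<open>The boundary curve lies in the zero set of a local defining function, and its gradient points
  in the direction of the outer normal, so the function is positive on short outer normals.\<close>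

lemma foot_point_outer:
  fixes \<rho> :: "real^2 \<Rightarrow> real"
  assumes U: "open U" and \<rho>: "\<Omega> \<inter> U = {x\<in>U. \<rho> x < 0}"
    and g: "\<And>x. x \<in> U \<Longrightarrow> (\<rho> has_derivative (\<lambda>v. g x \<bullet> v)) (at x)"
    and nz: "\<And>x. x \<in> U \<Longrightarrow> g x \<noteq> 0"
    and s: "\<gamma> s \<in> U"
  shows "\<rho> (\<gamma> s) = 0" "g (\<gamma> s) \<bullet> normal s = - norm (g (\<gamma> s))"
proof -
  have zero: "\<rho> x = 0" if x: "x \<in> C" "x \<in> U" for x
  proof -
    have "x \<notin> \<Omega>" using C_disjoint x by blast
    then have "\<rho> x \<ge> 0" using \<rho> x by force
    \<comment> \<open>Otherwise a whole neighbourhood of x would miss \<open>\<Omega>\<close>,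
      although x is a boundary point.\<close>
    moreover have "\<not> \<rho> x > 0"
    proof
      assume pos: "\<rho> x > 0"
      have "isCont \<rho> x" using g[OF x(2)] by (rule has_derivative_continuous)
      then have "\<forall>\<^sub>F y in at x. \<rho> y > 0"
        using pos order_tendstoD(1)[of \<rho> "\<rho> x" "at x" 0] by (auto simp: isCont_def)
      moreover have "\<forall>\<^sub>F y in at x. y \<in> U"
        using U x by (metis eventually_at_in_open')
      ultimately have "\<forall>\<^sub>F y in at x. y \<notin> \<Omega>"
        by eventually_elim (use \<rho> in force)
      then obtain d where d: "d > 0" "\<And>y. y \<noteq> x \<Longrightarrow> dist y x < d \<Longrightarrow> y \<notin> \<Omega>"
        unfolding eventually_at by auto
      have "x \<in> closure \<Omega>" using C_subset_frontier x by (auto simp: frontier_def)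
      then obtain y where "y \<in> \<Omega>" "dist y x < d" using d(1) closure_approachable by blast
      then show False using d(2)[of y] \<open>x \<notin> \<Omega>\<close> by auto
    qed
    ultimately show ?thesis by simp
  qed
  show "\<rho> (\<gamma> s) = 0" using zero s by simp
  have contg: "isCont \<gamma> s"
    using has_vector_derivative_continuous[OF has_vector_derivative_curve] .
  have near: "\<forall>\<^sub>F r in nhds s. \<gamma> r \<in> U"
    using contg U s by (metis isCont_def topological_tendstoD tendsto_at_iff_tendsto_nhds)
  have "((\<lambda>r. \<rho> (\<gamma> r)) has_derivative (\<lambda>h. g (\<gamma> s) \<bullet> (h *\<^sub>R tangent s))) (at s)"
    using has_derivative_compose[OF has_vector_derivative_curve[unfolded has_vector_derivative_def] g[OF s]] .
  \<comment> \<open>Near s the curve runs in the zero set of \<open>\<rho>\<close>, so the gradient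
    has no tangential component.\<close>
  moreover have "((\<lambda>r. \<rho> (\<gamma> r)) has_derivative (\<lambda>h. 0)) (at s)"
    using near by (intro has_derivative_transform_eventually[OF has_derivative_const[of 0]])
      (auto simp: eventually_at_filter zero s elim: eventually_mono)
  ultimately have "(\<lambda>h. g (\<gamma> s) \<bullet> (h *\<^sub>R tangent s)) = (\<lambda>h. 0)"
    by (rule has_derivative_unique)
  from fun_cong[OF this, of 1] have T: "g (\<gamma> s) \<bullet> tangent s = 0" by simp
  \<comment> \<open>With a positive value, \<open>\<rho>\<close> would grow from 0 along the inward
    normal, but short inward normals end in \<open>\<Omega>\<close>, where \<open>\<rho>\<close> is
    negative.\<close>
  have nonpos: "g (\<gamma> s) \<bullet> normal s \<le> 0"
  proof (rule ccontr)
    assume pos: "\<not> ?thesis"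
    define h where "h n = \<rho> (\<gamma> s + n *\<^sub>R normal s)" for n
    have "((\<lambda>n. \<gamma> s + n *\<^sub>R normal s) has_derivative (\<lambda>x. x *\<^sub>R normal s)) (at 0)"
      by (auto intro!: derivative_eq_intros)
    from has_derivative_compose[OF this, of \<rho> "\<lambda>v. g (\<gamma> s) \<bullet> v"] g[OF s]
    have "(h has_derivative (\<lambda>x. g (\<gamma> s) \<bullet> (x *\<^sub>R normal s))) (at 0)"
      unfolding h_def by simp
    then have "(h has_real_derivative (g (\<gamma> s) \<bullet> normal s)) (at 0)"
      unfolding has_field_derivative_def by (rule has_derivative_eq_rhs) (auto simp: fun_eq_iff)
    from DERIV_pos_inc_right[OF this] pos
    obtain d where d: "d > 0" "\<And>x. 0 < x \<Longrightarrow> x < d \<Longrightarrow> h 0 < h x"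
      by (metis add_0 not_le_imp_less)
    have "\<forall>\<^sub>F n in at_right 0. \<gamma> s + n *\<^sub>R normal s \<in> \<Omega>"
      using inward by (simp add: inward_oriented_def)
    moreover have "((\<lambda>n. \<gamma> s + n *\<^sub>R normal s) \<longlongrightarrow> \<gamma> s + 0 *\<^sub>R normal s) (at_right 0)"
      by (intro tendsto_intros)
    then have "\<forall>\<^sub>F n in at_right 0. \<gamma> s + n *\<^sub>R normal s \<in> U"
      using U s by (auto dest: topological_tendstoD)
    moreover have "\<forall>\<^sub>F n in at_right 0. n < d \<and> n > 0"
      using d(1) by (auto simp: eventually_at_right_field)
    ultimately have "\<forall>\<^sub>F n in at_right (0 :: real). False"
    proof eventually_elim
      case (elim n)
      then have "h n < 0" using \<rho> by (auto simp: h_def)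
      moreover have "h 0 = 0" using zero s by (simp add: h_def)
      ultimately show ?case using d(2)[of n] elim by simp
    qed
    then show False by (simp add: trivial_limit_at_right_real)
  qed
  have "g (\<gamma> s) = (g (\<gamma> s) \<bullet> normal s) *\<^sub>R normal s"
    using frame_decomposition[of "g (\<gamma> s)" s] T by simp
  then have "norm (g (\<gamma> s)) = \<bar>g (\<gamma> s) \<bullet> normal s\<bar>"
    by (metis norm_normal norm_scaleR mult.right_neutral real_norm_def)
  then show "g (\<gamma> s) \<bullet> normal s = - norm (g (\<gamma> s))" using nonpos by simp
qed

text \<open>The squared distance from q is differentiable along the curve and minimal at a nearest
  point. The vanishing derivative puts q on the normal line there.\<close>

lemma foot_point:
  obtains s where "infdist q C = dist q (\<gamma> s)" "(q - \<gamma> s) \<bullet> tangent s = 0"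
proof -
  obtain c where c: "c \<in> C" "infdist q C = dist q c"
    using infdist_attains_inf[OF C_closed C_nonempty] by blast
  then obtain s where s: "c = \<gamma> s" using range_eq by auto
  define f where "f r = (q - \<gamma> r) \<bullet> (q - \<gamma> r)" for r
  have "(f has_vector_derivative ((q - \<gamma> s) \<bullet> (0 - tangent s) + (0 - tangent s) \<bullet> (q - \<gamma> s))) (at s)"
    unfolding f_def
    by (intro bounded_bilinear.has_vector_derivative[OF bounded_bilinear_inner]
        has_vector_derivative_diff has_vector_derivative_const has_vector_derivative_curve)
  then have "(f has_real_derivative (- 2 * ((q - \<gamma> s) \<bullet> tangent s))) (at s)"
    by (simp add: has_real_derivative_iff_has_vector_derivative inner_commute)
  moreover have "f s \<le> f r" for r
  proof -
    have "dist q (\<gamma> s) \<le> dist q (\<gamma> r)" using c s infdist_le[of "\<gamma> r" C q] by simp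
    then show ?thesis by (simp add: f_def dist_norm norm_le)
  qed
  ultimately have "- 2 * ((q - \<gamma> s) \<bullet> tangent s) = 0"
    by (intro DERIV_local_min[of f _ s 1]) auto
  then show ?thesis using that[of s] c s by simp
qed

text \<open>The foot point leaves two positions for q on the normal line. The outer one is
  impossible close to z: the gradient hardly varies there, so the defining function grows from 0
  along the outward segment and would be positive at q.\<close>

lemma near_boundary_tubular:
  assumes z: "z \<in> C"
  obtains e where "e > 0" "\<And>q. q \<in> \<Omega> \<Longrightarrow> dist q z < e \<Longrightarrow> \<exists>s. q = tubular_map \<gamma> (infdist q C, s)"
proof -
  obtain U and \<rho> :: "real^2 \<Rightarrow> real" where U: "open U" "z \<in> U" and sm: "smooth_on U \<rho>"
    "\<forall>x\<in>U. frechet_derivative \<rho> (at x) \<noteq> (\<lambda>_. 0)" and \<rho>: "\<Omega> \<inter> U = {x\<in>U. \<rho> x < 0}"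
    using domain z C_subset_frontier unfolding smooth_bounded_domain_def by blast
  obtain g where g: "\<And>x. x \<in> U \<Longrightarrow> (\<rho> has_derivative (\<lambda>v. g x \<bullet> v)) (at x)"
    "continuous_on U g" "\<And>x. x \<in> U \<Longrightarrow> g x \<noteq> 0"
    using smooth_real_gradient[OF U(1) sm(1)] sm(2) by blast
  obtain e1 where e1: "e1 > 0" "ball z e1 \<subseteq> U" using U open_contains_ball by blast
  have "isCont g z" using g(2) U by (simp add: continuous_on_eq_continuous_at)
  \<comment> \<open>Three errors of this size occur: two between the gradients at a point of the
    segment and at the foot point, and one in the lower bound for the latter. Their sum stays below
    \<open>norm (g z)\<close>.\<close>
  moreover have "norm (g z) / 4 > 0" using g(3) U by simp
  ultimately obtain e2 where e2: "e2 > 0" "\<And>x. dist x z < e2 \<Longrightarrow> dist (g x) (g z) < norm (g z) / 4"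
    unfolding continuous_at_eps_delta by blast
  \<comment> \<open>Halved because the foot point is only known to lie within twice the radius: its
    distance to z is at most its distance to q plus that of q to z.\<close>
  define e where "e = min e1 e2 / 2"
  have e: "e > 0" using e1 e2 by (simp add: e_def)
  have "\<exists>s. q = tubular_map \<gamma> (infdist q C, s)" if q: "q \<in> \<Omega>" "dist q z < e" for q
  proof -
    obtain s where s: "infdist q C = dist q (\<gamma> s)" "(q - \<gamma> s) \<bullet> tangent s = 0"
      by (rule foot_point)
    define d where "d = infdist q C"
    define a where "a = (q - \<gamma> s) \<bullet> normal s"
    have qa: "q - \<gamma> s = a *\<^sub>R normal s"
      using frame_decomposition[of "q - \<gamma> s" s] s(2) by (simp add: a_def)
    then have da: "d = \<bar>a\<bar>" using s(1) by (simp add: d_def dist_norm)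
    have dz: "d < e" using infdist_le[OF z, of q] q by (simp add: d_def)
    have "a \<noteq> 0" using qa q C_disjoint curve_in_C by force
    moreover have "\<not> a < 0"
    proof
      assume "a < 0"
      then have ad: "a = - d" "d > 0" using da by auto
      have "dist (\<gamma> s) z < 2 * e"
        using dist_triangle2[of "\<gamma> s" z q] s(1) dz q by (simp add: d_def dist_commute)
      moreover have "dist q z < 2 * e" using q e by simp
      ultimately have seg: "closed_segment (\<gamma> s) q \<subseteq> ball z (2 * e)"
        by (intro closed_segment_subset) (auto simp: dist_commute)
      have pt: "\<gamma> s + (- t) *\<^sub>R normal s \<in> closed_segment (\<gamma> s) q" if "0 \<le> t" "t \<le> d" for t
      proof -
        have "q = \<gamma> s - d *\<^sub>R normal s" using qa ad by (simp add: algebra_simps)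
        then have "\<gamma> s + (- t) *\<^sub>R normal s = (1 - t / d) *\<^sub>R \<gamma> s + (t / d) *\<^sub>R q"
          using ad by (simp add: scaleR_diff_left scaleR_diff_right)
        then show ?thesis
          unfolding in_segment using that ad by (intro exI[of _ "t / d"]) auto
      qed
      have ball_U: "x \<in> U" "norm (g x - g z) < norm (g z) / 4" if "x \<in> ball z (2 * e)" for x
        using that e1(2) e2(2)[of x] by (auto simp: e_def dist_commute dist_norm[of "g x"])
      have sU: "\<gamma> s \<in> U" and sg: "norm (g (\<gamma> s) - g z) < norm (g z) / 4"
        using ball_U[of "\<gamma> s"] seg by auto
      note outer = foot_point_outer[OF U(1) \<rho> g(1,3) sU]
      define f where "f t = \<rho> (\<gamma> s + (- t) *\<^sub>R normal s)" for t
      have df: "(f has_real_derivative - (g (\<gamma> s + (- t) *\<^sub>R normal s) \<bullet> normal s)) (at t)"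
        if "0 \<le> t" "t \<le> d" for t
      proof -
        have 1: "((\<lambda>t. \<gamma> s + (- t) *\<^sub>R normal s) has_derivative (\<lambda>x. - x *\<^sub>R normal s)) (at t)"
          by (auto intro!: derivative_eq_intros)
        have "\<gamma> s + (- t) *\<^sub>R normal s \<in> U" using pt[OF that] seg ball_U by blast
        from has_derivative_compose[OF 1 g(1)[OF this]] show ?thesis
          unfolding f_def has_field_derivative_def
          by (rule has_derivative_eq_rhs) (auto simp: fun_eq_iff)
      qed
      obtain t where t: "0 < t" "t < d"
        "f d - f 0 = (d - 0) * - (g (\<gamma> s + (- t) *\<^sub>R normal s) \<bullet> normal s)"
        using MVT2[OF ad(2), of f "\<lambda>t. - (g (\<gamma> s + (- t) *\<^sub>R normal s) \<bullet> normal s)"] df by blast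
      let ?x = "\<gamma> s + (- t) *\<^sub>R normal s"
      have "?x \<in> ball z (2 * e)" using pt[of t] t seg by auto
      then have xg: "norm (g ?x - g z) < norm (g z) / 4" by (rule ball_U)
      have "g ?x \<bullet> normal s = g (\<gamma> s) \<bullet> normal s + (g ?x - g (\<gamma> s)) \<bullet> normal s"
        by (simp add: inner_diff_left)
      also have "\<dots> \<le> - norm (g (\<gamma> s)) + norm (g ?x - g (\<gamma> s))"
        using outer(2) norm_cauchy_schwarz[of "g ?x - g (\<gamma> s)" "normal s"] by simp
      also have "\<dots> < 0"
      proof -
        have "norm (g ?x - g (\<gamma> s)) \<le> norm (g ?x - g z) + norm (g (\<gamma> s) - g z)"
          using norm_triangle_ineq4[of "g ?x - g z" "g (\<gamma> s) - g z"] by simp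
        moreover have "norm (g z) \<le> norm (g (\<gamma> s)) + norm (g (\<gamma> s) - g z)"
          using norm_triangle_ineq4[of "g (\<gamma> s)" "g (\<gamma> s) - g z"] by simp
        ultimately show ?thesis using xg sg norm_ge_zero[of "g z"] by linarith
      qed
      finally have "f d - f 0 > 0" using t(3) ad(2) by (simp add: mult_pos_neg)
      moreover have "f 0 = 0" using outer by (simp add: f_def)
      moreover have "q = \<gamma> s + (- d) *\<^sub>R normal s"
        using qa ad(1) by (metis add.commute diff_add_cancel)
      from arg_cong[OF this, of \<rho>] have "f d = \<rho> q" by (simp only: f_def)
      ultimately have "\<rho> q > 0" by simp
      moreover have "q \<in> U" using seg ball_U by auto
      ultimately show False using \<rho> q by force
    qed
    ultimately have "q = tubular_map \<gamma> (infdist q C, s)"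
      using qa da by (simp add: tubular_map_def d_def algebra_simps)
    then show ?thesis by blast
  qed
  then show ?thesis using that e by blast
qed

end

section \<open>Motion in tubular coordinates\<close>

lemma newton_solution_components:
  assumes "is_solution (newton_field b) (\<Omega> \<times> UNIV) J x" "t \<in> J"
  shows "fst (x t) \<in> \<Omega>"
    and "((\<lambda>t. fst (x t)) has_vector_derivative snd (x t)) (at t)"
    and "((\<lambda>t. snd (x t)) has_vector_derivative - (b (fst (x t)) *\<^sub>R perp (snd (x t)))) (at t)"
proof -
  have x: "x t \<in> \<Omega> \<times> UNIV" "(x has_vector_derivative newton_field b (x t)) (at t)"
    using assms by (auto simp: is_solution_def)
  have eq: "newton_field b (x t) = (snd (x t), - (b (fst (x t)) *\<^sub>R perp (snd (x t))))"
    by (metis newton_field_eq prod.collapse)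
  show "fst (x t) \<in> \<Omega>" using x(1) by (simp add: mem_Times_iff)
  show "((\<lambda>t. fst (x t)) has_vector_derivative snd (x t)) (at t)"
    using bounded_linear.has_vector_derivative[OF bounded_linear_fst x(2)] by (simp add: eq)
  show "((\<lambda>t. snd (x t)) has_vector_derivative - (b (fst (x t)) *\<^sub>R perp (snd (x t)))) (at t)"
    using bounded_linear.has_vector_derivative[OF bounded_linear_snd x(2)] by (simp add: eq)
qed

text \<open>The magnetic force is orthogonal to the velocity, so it does no work.\<close>

lemma newton_speed_constant:
  assumes sol: "is_solution (newton_field b) (\<Omega> \<times> UNIV) J x"
  obtains V where "V \<ge> 0" "\<And>t. t \<in> J \<Longrightarrow> norm (snd (x t)) = V"
proof -
  let ?v = "\<lambda>t. snd (x t)"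
  have "((\<lambda>t. ?v t \<bullet> ?v t) has_vector_derivative 0) (at t within J)" if "t \<in> J" for t
  proof -
    note d = newton_solution_components(3)[OF sol that]
    have "((\<lambda>t. ?v t \<bullet> ?v t) has_vector_derivative 0) (at t)"
      using bounded_bilinear.has_vector_derivative[OF bounded_bilinear_inner d d] by simp
    then show ?thesis by (rule has_vector_derivative_at_within)
  qed
  moreover have "convex J" using sol by (auto simp: is_solution_def is_interval_convex_1)
  ultimately obtain c where c: "\<And>t. t \<in> J \<Longrightarrow> ?v t \<bullet> ?v t = c"
    using has_vector_derivative_zero_constant[of J "\<lambda>t. ?v t \<bullet> ?v t"] by blast
  obtain t0 where "t0 \<in> J" using sol by (auto simp: is_solution_def)
  then have "sqrt c \<ge> 0" using c by (metis inner_ge_zero real_sqrt_ge_zero)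
  then show ?thesis using that[of "sqrt c"] c by (simp add: norm_eq_sqrt_inner)
qed

section \<open>Coordinates, velocity and momentum in the collar\<close>

context tubular_neighborhood
begin

lemma width_pos: "\<delta> > 0"
  using chart by (simp add: tubular_chart_def)

lemma tubular_map_eq: "tubular_map \<gamma> (n, s) = \<gamma> s + n *\<^sub>R normal s"
  by (simp add: tubular_map_def)

lemma circle_rep_eqs:
  "tangent (circle_rep L s) = tangent s" "normal (circle_rep L s) = normal s"
  "curvature (circle_rep L s) = curvature s" "\<gamma> (circle_rep L s) = \<gamma> s"
  by (rule periodic_circle_rep[where L = L], rule tangent_periodic normal_periodic curvature_periodic periodic)+

lemma tubular_map_circle_rep: "tubular_map \<gamma> (n, circle_rep L s) = tubular_map \<gamma> (n, s)"
  by (simp add: tubular_map_eq circle_rep_eqs)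

lemma tubular_map_in_collar:
  assumes "n \<in> {0<..<\<delta>}"
  shows "tubular_map \<gamma> (n, s) \<in> collar \<Omega> C \<delta>"
proof -
  have "tubular_map \<gamma> (n, circle_rep L s) \<in> collar \<Omega> C \<delta>"
    using chart circle_rep_mem[OF L_pos] assms by (intro bij_betw_apply[of "tubular_map \<gamma>"]) (auto simp: tubular_chart_def)
  then show ?thesis by (simp add: tubular_map_circle_rep)
qed

lemma tubular_map_in_domain: "n \<in> {0<..<\<delta>} \<Longrightarrow> tubular_map \<gamma> (n, s) \<in> \<Omega>"
  using tubular_map_in_collar by (auto simp: collar_def)

text \<open>A point determines s only modulo L. Hence the conclusion compares n and periodic
  functions of s, not s itself.\<close>

lemma tubular_map_inj:
  assumes n: "n \<in> {0<..<\<delta>}" "n' \<in> {0<..<\<delta>}"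
    and eq: "tubular_map \<gamma> (n, s) = tubular_map \<gamma> (n', s')"
  shows "n = n'" "tangent s = tangent s'" "curvature s = curvature s'"
proof -
  have "inj_on (tubular_map \<gamma>) ({0<..<\<delta>} \<times> {0..<L})"
    using chart by (auto simp: tubular_chart_def bij_betw_def)
  moreover have "tubular_map \<gamma> (n, circle_rep L s) = tubular_map \<gamma> (n', circle_rep L s')"
    using eq by (simp add: tubular_map_circle_rep)
  ultimately have "(n, circle_rep L s) = (n', circle_rep L s')"
    using n circle_rep_mem[OF L_pos] by (intro inj_onD[of "tubular_map \<gamma>"]) auto
  then show "n = n'" "tangent s = tangent s'" "curvature s = curvature s'"
    using circle_rep_eqs(1,3)[of s] circle_rep_eqs(1,3)[of s'] by auto
qed

text \<open>The inverse of the chart is given by local lifts, so differentiable coordinates of the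
  motion are available near one time only, by composing it with such a lift.\<close>

lemma local_coordinates:
  assumes q: "(q has_vector_derivative v) (at t)" and t: "q t \<in> collar \<Omega> C \<delta>"
  obtains n s n' s' where "(n has_real_derivative n') (at t)" "(s has_real_derivative s') (at t)"
    "\<forall>\<^sub>F r in nhds t. n r \<in> {0<..<\<delta>} \<and> tubular_map \<gamma> (n r, s r) = q r"
proof -
  obtain V \<phi> where V: "open V" "q t \<in> V" and sm: "smooth_on V \<phi>"
    and im: "\<phi> ` V \<subseteq> {0<..<\<delta>} \<times> UNIV" and inv: "\<forall>x\<in>V. tubular_map \<gamma> (\<phi> x) = x"
    using chart t unfolding tubular_chart_def by blast
  have "Ck_on (Suc 0) \<phi> V" using sm by (auto simp: smooth_on_def)
  then have "\<phi> differentiable (at (q t))"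
    using V by (auto simp: differentiable_on_eq_differentiable_at)
  then obtain D where D: "(\<phi> has_derivative D) (at (q t))" by (auto simp: differentiable_def)
  interpret linear D using D by (rule has_derivative_linear)
  have "((\<lambda>r. \<phi> (q r)) has_derivative (\<lambda>h. D (h *\<^sub>R v))) (at t)"
    using has_derivative_compose[OF q[unfolded has_vector_derivative_def] D] .
  then have d: "((\<lambda>r. \<phi> (q r)) has_vector_derivative D v) (at t)"
    by (simp add: has_vector_derivative_def scale)
  have "isCont q t" using has_vector_derivative_continuous[OF q] .
  then have "\<forall>\<^sub>F r in nhds t. q r \<in> V"
    using V by (metis isCont_def topological_tendstoD tendsto_at_iff_tendsto_nhds)
  then have "\<forall>\<^sub>F r in nhds t. fst (\<phi> (q r)) \<in> {0<..<\<delta>} \<and> tubular_map \<gamma> (fst (\<phi> (q r)), snd (\<phi> (q r))) = q r"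
  proof eventually_elim
    case (elim r)
    then have "\<phi> (q r) \<in> {0<..<\<delta>} \<times> UNIV" using im by blast
    then show ?case using inv elim by (auto simp: mem_Times_iff)
  qed
  moreover have "((\<lambda>r. fst (\<phi> (q r))) has_real_derivative fst (D v)) (at t)"
    using bounded_linear.has_vector_derivative[OF bounded_linear_fst d]
    by (simp add: has_real_derivative_iff_has_vector_derivative)
  moreover have "((\<lambda>r. snd (\<phi> (q r))) has_real_derivative snd (D v)) (at t)"
    using bounded_linear.has_vector_derivative[OF bounded_linear_snd d]
    by (simp add: has_real_derivative_iff_has_vector_derivative)
  ultimately show ?thesis using that by blast
qed

text \<open>By the Frenet equations the derivative of \<open>\<gamma>\<close> + n N is (1 - n k) s'
  T + n' N; both claims are its components in the frame.\<close>

lemma tubular_velocity: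
  assumes n: "(n has_real_derivative n') (at t)" and s: "(s has_real_derivative s') (at t)"
    and q: "(q has_vector_derivative v) (at t)"
    and eq: "\<forall>\<^sub>F r in nhds t. tubular_map \<gamma> (n r, s r) = q r"
  shows "n' = v \<bullet> normal (s t)" "(1 - n t * curvature (s t)) * s' = v \<bullet> tangent (s t)"
proof -
  have 1: "((\<lambda>r. \<gamma> (s r)) has_vector_derivative s' *\<^sub>R tangent (s t)) (at t)"
    using vector_diff_chain_at[OF s[unfolded has_real_derivative_iff_has_vector_derivative]
        has_vector_derivative_curve] by (simp add: o_def)
  have 2: "((\<lambda>r. normal (s r)) has_vector_derivative s' *\<^sub>R - (curvature (s t) *\<^sub>R tangent (s t))) (at t)"
    using vector_diff_chain_at[OF s[unfolded has_real_derivative_iff_has_vector_derivative]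
        has_vector_derivative_normal] by (simp add: o_def)
  have "((\<lambda>r. \<gamma> (s r) + n r *\<^sub>R normal (s r)) has_vector_derivative
      s' *\<^sub>R tangent (s t) + (n t *\<^sub>R (s' *\<^sub>R - (curvature (s t) *\<^sub>R tangent (s t))) + n' *\<^sub>R normal (s t))) (at t)"
    by (intro has_vector_derivative_add 1 has_vector_derivative_scaleR n 2)
  moreover have "((\<lambda>r. \<gamma> (s r) + n r *\<^sub>R normal (s r)) has_vector_derivative v) (at t)"
  proof -
    obtain S where S: "open S" "t \<in> S" "\<forall>r\<in>S. tubular_map \<gamma> (n r, s r) = q r"
      using eq unfolding eventually_nhds by blast
    show ?thesis
      by (rule has_vector_derivative_transform_within_open[OF q S(1,2)]) (use S(3) in \<open>simp add: tubular_map_eq\<close>)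
  qed
  ultimately have v: "v = s' *\<^sub>R tangent (s t) + (n t *\<^sub>R (s' *\<^sub>R - (curvature (s t) *\<^sub>R tangent (s t))) + n' *\<^sub>R normal (s t))"
    by (rule vector_derivative_unique_at[symmetric])
  show "n' = v \<bullet> normal (s t)"
    by (simp add: v inner_add_left inner_diff_left)
  show "(1 - n t * curvature (s t)) * s' = v \<bullet> tangent (s t)"
    by (simp add: v inner_add_left inner_diff_left algebra_simps)
qed

text \<open>The factor 1 - n k turns the tangential velocity into the momentum along s. With it the
  two terms in k n' (v . T) cancel, because (1 - n k) s' = v . T; what remains is the magnetic term
  and one with the derivative of k.\<close>

lemma tangential_momentum_derivative:
  assumes n: "(n has_real_derivative n') (at t)" and s: "(s has_real_derivative s') (at t)"
    and v: "(v has_vector_derivative - (\<beta> *\<^sub>R perp (v t))) (at t)"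
    and k': "(curvature has_real_derivative k') (at (s t))"
    and vel: "n' = v t \<bullet> normal (s t)" "(1 - n t * curvature (s t)) * s' = v t \<bullet> tangent (s t)"
  shows "((\<lambda>r. (1 - n r * curvature (s r)) * (v r \<bullet> tangent (s r))) has_real_derivative
    \<beta> * (1 - n t * curvature (s t)) * n' - n t * k' * s' * (v t \<bullet> tangent (s t))) (at t)"
proof -
  have 1: "((\<lambda>r. tangent (s r)) has_vector_derivative s' *\<^sub>R (curvature (s t) *\<^sub>R normal (s t))) (at t)"
    using vector_diff_chain_at[OF s[unfolded has_real_derivative_iff_has_vector_derivative]
        has_vector_derivative_tangent] by (simp add: o_def)
  have "((\<lambda>r. v r \<bullet> tangent (s r)) has_real_derivative
     (v t \<bullet> s' *\<^sub>R (curvature (s t) *\<^sub>R normal (s t)) + - (\<beta> *\<^sub>R perp (v t)) \<bullet> tangent (s t))) (at t)"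
    using bounded_bilinear.has_vector_derivative[OF bounded_bilinear_inner v 1]
    by (simp add: has_real_derivative_iff_has_vector_derivative)
  moreover have "perp (v t) \<bullet> tangent (s t) = - n'"
    by (simp add: inner_perp_swap perp_tangent vel(1))
  ultimately have 2: "((\<lambda>r. v r \<bullet> tangent (s r)) has_real_derivative (s' * curvature (s t) * n' + \<beta> * n')) (at t)"
    by (simp add: vel(1) mult.assoc)
  have 3: "((\<lambda>r. curvature (s r)) has_real_derivative k' * s') (at t)"
    using DERIV_chain2[OF k' s] .
  have "((\<lambda>r. (1 - n r * curvature (s r)) * (v r \<bullet> tangent (s r))) has_real_derivative
     (0 - (n' * curvature (s t) + (k' * s') * n t)) * (v t \<bullet> tangent (s t))
       + (s' * curvature (s t) * n' + \<beta> * n') * (1 - n t * curvature (s t))) (at t)"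
    by (intro DERIV_mult DERIV_diff DERIV_const n 2 3)
  then show ?thesis
    by (rule DERIV_cong) (simp add: vel(2)[symmetric] algebra_simps)
qed

text \<open>The parameter integral runs over a compact interval. Its continuity is what makes F
  differentiable.\<close>

lemma flux_density_continuous:
  assumes b: "continuous_on \<Omega> b"
  shows "continuous_on {0<..<\<delta>} (\<lambda>n. integral {0..L} (\<lambda>s. tubular_field b \<gamma> n s))"
proof -
  have c: "continuous_on UNIV \<gamma>" "continuous_on UNIV normal" "continuous_on UNIV curvature"
  proof -
    obtain k' where "\<And>s. (curvature has_real_derivative k' s) (at s)"
      "continuous_on UNIV k'" "\<And>s. k' (s + L) = k' s" using curvature_C1 by blast
    from this(1) show "continuous_on UNIV curvature"
      by (intro continuous_at_imp_continuous_on ballI DERIV_isCont)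
  qed (use has_vector_derivative_continuous[OF has_vector_derivative_curve]
      has_vector_derivative_continuous[OF has_vector_derivative_normal] in
      \<open>simp_all add: continuous_at_imp_continuous_on\<close>)
  have c': "continuous_on S (\<lambda>x. f (snd x))" if "continuous_on UNIV f"
    for f :: "real \<Rightarrow> 'b::topological_space" and S :: "(real \<times> real) set"
    by (rule continuous_on_compose2[OF that]) (auto intro!: continuous_intros)
  have "continuous_on ({0<..<\<delta>} \<times> cbox 0 L) (\<lambda>x. b (\<gamma> (snd x) + fst x *\<^sub>R normal (snd x)))"
    by (rule continuous_on_compose2[OF b])
      (use tubular_map_in_domain in \<open>auto intro!: continuous_intros c' c simp: tubular_map_eq\<close>)
  then have "continuous_on ({0<..<\<delta>} \<times> cbox 0 L) (\<lambda>x. tubular_field b \<gamma> (fst x) (snd x))"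
    unfolding tubular_field_def tubular_map_eq by (intro continuous_intros c' c)
  then have "continuous_on {0<..<\<delta>} (\<lambda>n. integral (cbox 0 L) (\<lambda>s. tubular_field b \<gamma> n s))"
    by (intro integral_continuous_on_param) (simp add: case_prod_unfold)
  then show ?thesis by simp
qed

end

lemma lower_integral_has_real_derivative:
  fixes f :: "real \<Rightarrow> real"
  assumes f: "continuous_on {0<..<d} f"
    and int: "\<And>n. 0 < n \<Longrightarrow> n < d \<Longrightarrow> f integrable_on {n..d}"
    and n: "n \<in> {0<..<d}"
  shows "((\<lambda>n. integral {n..d} f) has_real_derivative - f n) (at n)"
proof -
  \<comment> \<open>The integrand is continuous on the open interval, while up to \<open>d\<close>
    it is only known to be integrable. So the derivative is taken on \<open>{a..c}\<close>, away
    from both ends, and the rest of the integral is a constant.\<close>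
  define a where "a = n / 2"
  define c where "c = (n + d) / 2"
  have ac: "0 < a" "n \<in> {a<..<c}" "c < d" using n by (auto simp: a_def c_def)
  have "((\<lambda>m. integral {a..m} f) has_real_derivative f n) (at n within {a..c})"
    unfolding has_real_derivative_iff_has_vector_derivative
    using ac by (intro integral_has_vector_derivative continuous_on_subset[OF f]) auto
  then have "((\<lambda>m. integral {a..m} f) has_real_derivative f n) (at n within {a<..<c})"
    by (rule DERIV_subset) auto
  then have "((\<lambda>m. integral {a..m} f) has_real_derivative f n) (at n)"
    by (simp only: at_within_open[OF ac(2) open_greaterThanLessThan])
  then have d: "((\<lambda>m. integral {a..d} f - integral {a..m} f) has_real_derivative - f n) (at n)"
    by (auto intro!: derivative_eq_intros)
  have eq: "integral {a..d} f - integral {a..m} f = integral {m..d} f" if "m \<in> {a<..<c}" for m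
    using Henstock_Kurzweil_Integration.integral_combine[of a m d f] int[of a] that ac by auto
  show ?thesis
    by (rule has_field_derivative_transform_within_open[OF d open_greaterThanLessThan ac(2)]) (rule eq)
qed

section \<open>The flux stays bounded along a motion that approaches the boundary\<close>

context tubular_neighborhood
begin

text \<open>All estimates take place on \<open>S\<close>, the part of J close to T, where the
  distance serves as coordinate and 1 - n k stays away from 0. As \<open>S\<close> is an interval of
  finite length, a bound on G' bounds G.\<close>

lemma no_boundary_limit:
  assumes b: "continuous_on \<Omega> b"
    and int: "\<And>n. 0 < n \<Longrightarrow> n < \<delta> \<Longrightarrow>
      (\<lambda>\<eta>. integral {0..L} (\<lambda>\<xi>. tubular_field b \<gamma> \<eta> \<xi>)) integrable_on {n..\<delta>}"
    and divergence: "filterlim (\<lambda>n. \<bar>integral {n..\<delta>}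
      (\<lambda>\<eta>. integral {0..L} (\<lambda>\<xi>. tubular_field b \<gamma> \<eta> \<xi>))\<bar>) at_top (at_right 0)"
    and M: "M \<ge> 0" "\<And>n s. n \<in> {0<..<\<delta>} \<Longrightarrow>
      \<bar>tubular_field b \<gamma> n s - 1 / L * integral {0..L} (\<lambda>\<xi>. tubular_field b \<gamma> n \<xi>)\<bar> \<le> M"
    and sol: "is_solution (newton_field b) (\<Omega> \<times> UNIV) J x"
    and T: "T \<in> closure J"
    and lim: "((\<lambda>t. fst (x t)) \<longlongrightarrow> z) (at T within J)"
    and z: "z \<in> C"
  shows False
proof -
  define q where "q t = fst (x t)" for t
  define v where "v t = snd (x t)" for t
  note lim = lim[folded q_def]
  have q: "q t \<in> \<Omega>" "(q has_vector_derivative v t) (at t)"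
    and v: "(v has_vector_derivative - (b (q t) *\<^sub>R perp (v t))) (at t)" if "t \<in> J" for t
    using newton_solution_components[OF sol that] unfolding q_def[abs_def] v_def[abs_def] by auto
  have J: "open J" "convex J" using sol by (auto simp: is_solution_def is_interval_convex_1)
  \<comment> \<open>At a time of J the limit would be the position itself, which lies in the open
    set \<open>\<Omega>\<close> and not on its boundary.\<close>
  have "T \<notin> J"
  proof
    assume TJ: "T \<in> J"
    have "isCont q T" using has_vector_derivative_continuous[OF q(2)[OF TJ]] .
    then have "(q \<longlongrightarrow> q T) (at T)" by (simp add: isCont_def)
    moreover have "(q \<longlongrightarrow> z) (at T)" using lim at_within_open[OF TJ J(1)] by simp
    ultimately have "q T = z" using tendsto_unique trivial_limit_at by blast
    then show False using q(1)[OF TJ] z C_disjoint by simp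
  qed
  obtain V where V: "V \<ge> 0" "\<And>t. t \<in> J \<Longrightarrow> norm (v t) = V"
    using newton_speed_constant[OF sol] unfolding v_def by blast
  have V_inner: "\<bar>v t \<bullet> e\<bar> \<le> V" if "t \<in> J" "norm e = 1" for t e
    using Cauchy_Schwarz_ineq2[of "v t" e] V(2)[OF that(1)] that(2) by simp
  obtain K k' where K: "K > 0" "\<And>s. \<bar>curvature s\<bar> \<le> K"
    "\<And>s. (curvature has_real_derivative k' s) (at s)" "\<And>s. \<bar>k' s\<bar> \<le> K"
    using curvature_bounds by blast
  obtain e where e: "e > 0" "\<And>p. p \<in> \<Omega> \<Longrightarrow> dist p z < e \<Longrightarrow> \<exists>s. p = tubular_map \<gamma> (infdist p C, s)"
    using near_boundary_tubular[OF z] by blast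
  \<comment> \<open>The three radii secure the foot point description, the chart width, and n K
    \<le> 1/2. The last one gives 1 - n k \<ge> 1/2, so that s' is at most twice the speed.\<close>
  define e' where "e' = min e (min \<delta> (1 / (2 * K)))"
  have "e' > 0" using e(1) width_pos K(1) by (simp add: e'_def)
  with lim have "\<forall>\<^sub>F t in at T within J. dist (q t) z < e'" by (rule tendstoD)
  then obtain r where r: "r > 0" "\<And>t. t \<in> J \<Longrightarrow> t \<noteq> T \<Longrightarrow> dist t T < r \<Longrightarrow> dist (q t) z < e'"
    unfolding eventually_at by blast
  define S where "S = J \<inter> ball T r"
  have S: "open S" "convex S" "S \<subseteq> J" using J by (auto simp: S_def convex_Int)
  have qz: "dist (q t) z < e'" if "t \<in> S" for t
    using r(2)[of t] that \<open>T \<notin> J\<close> by (auto simp: S_def dist_commute)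
  define n where "n t = infdist (q t) C" for t
  have n: "n t \<in> {0<..<\<delta>}" "n t * K \<le> 1 / 2" if t: "t \<in> S" for t
  proof -
    have "q t \<notin> C" using q(1) t S(3) C_disjoint by blast
    then have "n t > 0"
      unfolding n_def using infdist_pos_not_in_closed[OF C_closed C_nonempty] by blast
    moreover have "n t < e'" using infdist_le[OF z, of "q t"] qz[OF t] by (simp add: n_def)
    ultimately show "n t \<in> {0<..<\<delta>}" by (simp add: e'_def)
    have "n t < 1 / (2 * K)" using \<open>n t < e'\<close> by (simp add: e'_def)
    then show "n t * K \<le> 1 / 2" using K(1) by (simp add: field_simps)
  qed
  have "\<forall>t\<in>S. \<exists>s. tubular_map \<gamma> (n t, s) = q t"
    using e(2) q(1) qz S(3) unfolding n_def e'_def by (metis min_less_iff_conj subsetD)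
  \<comment> \<open>This choice is made separately at each time and may jump. It does no harm, since
    \<open>w\<close> depends on it only through the tangent and the curvature, which are
    L-periodic.\<close>
  then obtain \<sigma> where \<sigma>: "\<And>t. t \<in> S \<Longrightarrow> tubular_map \<gamma> (n t, \<sigma> t) = q t" by metis
  define I where "I n = integral {0..L} (\<lambda>\<xi>. tubular_field b \<gamma> n \<xi>)" for n
  define F where "F n = integral {n..\<delta>} I" for n
  have dF: "(F has_real_derivative - I n) (at n)" if "n \<in> {0<..<\<delta>}" for n
    unfolding F_def using flux_density_continuous[OF b] int that
    by (intro lower_integral_has_real_derivative) (auto simp: I_def[abs_def])
  define w where "w t = (1 - n t * curvature (\<sigma> t)) * (v t \<bullet> tangent (\<sigma> t))" for t
  define G where "G t = w t - F (n t) / L" for t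
  \<comment> \<open>The first summand is the oscillation bound times |n'| \<le> V. The second is 1/2
    * 2 V * V, from the bounds on n k', on s' and on v . T.\<close>
  define D where "D = M * V + V * V"
  have nk: "\<bar>n t * curvature s\<bar> \<le> 1 / 2" if "t \<in> S" for t s
  proof -
    have "\<bar>n t * curvature s\<bar> \<le> n t * K"
      using n(1)[OF that] K(2)[of s] by (simp add: abs_mult mult_left_mono)
    then show ?thesis using n(2)[OF that] by linarith
  qed
  have dG: "\<exists>G'. (G has_real_derivative G') (at t) \<and> norm G' \<le> D" if t: "t \<in> S" for t
  proof -
    have tJ: "t \<in> J" using t S by blast
    have qc: "q t \<in> collar \<Omega> C \<delta>" using tubular_map_in_collar[OF n(1)[OF t]] \<sigma>[OF t] by metis
    obtain m s m' s' where ms: "(m has_real_derivative m') (at t)" "(s has_real_derivative s') (at t)"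
      and ev: "\<forall>\<^sub>F r in nhds t. m r \<in> {0<..<\<delta>} \<and> tubular_map \<gamma> (m r, s r) = q r"
      by (rule local_coordinates[OF q(2)[OF tJ] qc]) (rule that)
    have "\<forall>\<^sub>F r in nhds t. tubular_map \<gamma> (m r, s r) = q r"
      using ev by (rule eventually_mono) (rule conjunct2)
    note vel = tubular_velocity[OF ms q(2)[OF tJ] this]
    \<comment> \<open>Near t, injectivity of the chart identifies the local coordinate
      \<open>m\<close> with the distance and allows \<open>G\<close> to be written with the
      differentiable \<open>s\<close> in place of \<open>\<sigma>\<close>.\<close>
    have same: "\<forall>\<^sub>F r in nhds t. m r = n r \<and>
        (1 - m r * curvature (s r)) * (v r \<bullet> tangent (s r)) - F (m r) / L = G r"
      using ev eventually_nhds_in_open[OF S(1) t]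
    proof eventually_elim
      case (elim r)
      then have "m r \<in> {0<..<\<delta>}" "tubular_map \<gamma> (m r, s r) = tubular_map \<gamma> (n r, \<sigma> r)"
        using \<sigma> by auto
      from tubular_map_inj[OF this(1) n(1)[OF elim(2)] this(2)] show ?case
        by (simp add: G_def w_def)
    qed
    have mt: "m t = n t" using eventually_nhds_x_imp_x[OF same] by simp
    have qt: "tubular_map \<gamma> (n t, s t) = q t" using eventually_nhds_x_imp_x[OF ev] mt by simp
    let ?B = "tubular_field b \<gamma> (n t) (s t)"
    define X where "X = (?B - 1 / L * I (n t)) * m'"
    define Y where "Y = n t * k' (s t) * s' * (v t \<bullet> tangent (s t))"
    define G' where "G' = - X - Y"
    have dFm: "((\<lambda>r. F (m r) / L) has_real_derivative (- I (n t) * m') / L) (at t)"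
      by (intro DERIV_cdivide DERIV_chain2[OF _ ms(1)]) (use dF[OF n(1)[OF t]] mt in simp)
    have "((\<lambda>r. (1 - m r * curvature (s r)) * (v r \<bullet> tangent (s r)) - F (m r) / L) has_real_derivative
       b (q t) * (1 - m t * curvature (s t)) * m' - m t * k' (s t) * s' * (v t \<bullet> tangent (s t))
         - (- I (n t) * m') / L) (at t)"
      by (intro DERIV_diff dFm tangential_momentum_derivative[OF ms v[OF tJ] K(3) vel])
    \<comment> \<open>By definition of \<open>tubular_field\<close> the magnetic term is -B n', and
      -F / L contributes the mean of B times n'; together they are \<open>- X\<close>.\<close>
    then have dG': "((\<lambda>r. (1 - m r * curvature (s r)) * (v r \<bullet> tangent (s r)) - F (m r) / L) has_real_derivative G') (at t)"
      by (rule DERIV_cong) (simp add: G'_def X_def Y_def mt tubular_field_def qt algebra_simps)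
    have "\<forall>\<^sub>F r in nhds t. (1 - m r * curvature (s r)) * (v r \<bullet> tangent (s r)) - F (m r) / L = G r"
      using same by (rule eventually_mono) (rule conjunct2)
    then have "(G has_real_derivative G') (at t)"
      by (rule iffD1[OF DERIV_cong_ev[OF refl _ refl] dG'])
    moreover have "norm G' \<le> D"
    proof -
      have "\<bar>m'\<bar> \<le> V" using vel(1) V_inner[OF tJ, of "normal (s t)"] by simp
      then have 1: "\<bar>X\<bar> \<le> M * V"
        unfolding X_def abs_mult I_def using M n(1)[OF t] V(1) by (intro mult_mono) auto
      have vT: "\<bar>v t \<bullet> tangent (s t)\<bar> \<le> V" using V_inner[OF tJ] by simp
      have "1 / 2 * \<bar>s'\<bar> \<le> \<bar>1 - n t * curvature (s t)\<bar> * \<bar>s'\<bar>"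
        using nk[OF t, of "s t"] by (intro mult_right_mono) auto
      also have "\<dots> \<le> V" using vel(2) vT mt by (simp flip: abs_mult)
      finally have s': "\<bar>s'\<bar> \<le> 2 * V" by simp
      have nk': "\<bar>n t * k' (s t)\<bar> \<le> 1 / 2"
      proof -
        have "\<bar>n t * k' (s t)\<bar> \<le> n t * K"
          using n(1)[OF t] K(4)[of "s t"] by (simp add: abs_mult mult_left_mono)
        then show ?thesis using n(2)[OF t] by linarith
      qed
      have "\<bar>Y\<bar> \<le> 1 / 2 * (2 * V) * V"
        unfolding Y_def abs_mult[of "n t * k' (s t) * s'"] abs_mult[of "n t * k' (s t)"]
        using nk' s' vT V(1) by (intro mult_mono) auto
      then show ?thesis using 1 unfolding G'_def D_def by simp
    qed
    ultimately show ?thesis by blast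
  qed
  have nontriv: "at T within J \<noteq> bot"
    using T \<open>T \<notin> J\<close> by (auto simp: trivial_limit_within islimpt_in_closure)
  have ev_S: "\<forall>\<^sub>F t in at T within J. t \<in> S"
    unfolding eventually_at S_def using r(1) by (auto simp: dist_commute)
  obtain t0 where t0: "t0 \<in> S"
    using eventually_happens'[OF nontriv ev_S] by blast
  have wb: "\<bar>w t\<bar> \<le> 2 * V" if "t \<in> S" for t
    unfolding w_def abs_mult using nk[OF that, of "\<sigma> t"] V_inner[of t "tangent (\<sigma> t)"] that S(3) V(1)
    by (intro mult_mono) auto
  \<comment> \<open>Here \<open>2 * V\<close> bounds \<open>w\<close>, as |1 - n k| \<le> 3/2, and
    \<open>2 * r\<close> bounds the length of \<open>S\<close>.\<close>
  define B where "B = L * (2 * V + \<bar>G t0\<bar> + D * (2 * r))"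
  have bound: "\<bar>F (n t)\<bar> \<le> B" if t: "t \<in> S" for t
  proof -
    obtain G' where G': "\<And>t. t \<in> S \<Longrightarrow> (G has_real_derivative G' t) (at t) \<and> norm (G' t) \<le> D"
      using dG by metis
    have "norm (G t - G t0) \<le> D * norm (t - t0)"
      by (rule field_differentiable_bound[OF S(2)]) (use G' t t0 in \<open>auto intro: DERIV_subset\<close>)
    also have "\<dots> \<le> D * (2 * r)"
      using t t0 V(1) M(1) by (intro mult_left_mono) (auto simp: S_def D_def dist_real_def)
    finally have "\<bar>G t\<bar> \<le> \<bar>G t0\<bar> + D * (2 * r)" by simp
    moreover have "\<bar>F (n t) / L\<bar> \<le> \<bar>w t\<bar> + \<bar>G t\<bar>" by (simp add: G_def)
    ultimately have "\<bar>F (n t) / L\<bar> \<le> 2 * V + \<bar>G t0\<bar> + D * (2 * r)" using wb[OF t] by linarith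
    then show ?thesis using L_pos by (simp add: B_def abs_divide divide_le_eq mult.commute)
  qed
  have "infdist z C = 0" using z by simp
  then have "(n \<longlongrightarrow> 0) (at T within J)"
    unfolding n_def using tendsto_infdist[OF lim, of C] by simp
  moreover have "\<forall>\<^sub>F t in at T within J. n t \<in> {0<..} \<and> n t \<noteq> 0"
    using ev_S by (rule eventually_mono) (drule n(1), simp)
  ultimately have "filterlim n (at_right 0) (at T within J)"
    by (simp add: filterlim_at)
  from filterlim_compose[OF divergence this]
  have "filterlim (\<lambda>t. \<bar>F (n t)\<bar>) at_top (at T within J)"
    by (simp add: F_def I_def[abs_def])
  then have "\<forall>\<^sub>F t in at T within J. \<bar>F (n t)\<bar> \<ge> B + 1"
    by (simp add: filterlim_at_top)
  with ev_S have "\<forall>\<^sub>F t in at T within J. False"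
    by eventually_elim (use bound in force)
  then show False using nontriv by (simp add: eventually_False)
qed

end

section \<open>Limits at a finite end time and completeness of Newton's equation\<close>

lemma bounded_derivative_has_limit:
  fixes f :: "real \<Rightarrow> 'a::euclidean_space"
  assumes J: "convex J"
    and der: "\<And>t. t \<in> J \<Longrightarrow> (f has_vector_derivative f' t) (at t)"
    and bd: "\<And>t. t \<in> J \<Longrightarrow> norm (f' t) \<le> B" and T: "T \<in> closure J"
  obtains l where "(f \<longlongrightarrow> l) (at T within J)"
proof -
  have "norm (f s - f t) \<le> max B 0 * norm (s - t)" if "s \<in> J" "t \<in> J" for s t
  proof (rule differentiable_bound[OF J _ _ that])
    show "(f has_derivative (\<lambda>h. h *\<^sub>R f' t)) (at t within J)" if "t \<in> J" for t
      using der[OF that] unfolding has_vector_derivative_def by (rule has_derivative_at_withinI)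
    show "onorm (\<lambda>h. h *\<^sub>R f' t) \<le> max B 0" if "t \<in> J" for t
    proof (rule onorm_le)
      fix h :: real
      show "norm (h *\<^sub>R f' t) \<le> max B 0 * norm h"
        using mult_right_mono[of "norm (f' t)" "max B 0" "\<bar>h\<bar>"] bd[OF that]
        by (simp add: mult.commute)
    qed
  qed
  then have "(max B 0)-lipschitz_on J f"
    by (intro lipschitz_onI) (auto simp: dist_norm)
  then have "uniformly_continuous_on J f" by (rule lipschitz_on_uniformly_continuous)
  then show ?thesis
    using uniformly_continuous_on_extension_at_closure[OF _ T] that by metis
qed

text \<open>On a ball, \<open>B\<close> bounds the field and \<open>W\<close> the velocity. The
  splitting b1 v1 - b2 v2 = b1 (v1 - v2) + (b1 - b2) v2 then yields the constant
  \<open>B + K * W\<close>, to which the position equation adds 1.\<close>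

lemma local_lipschitz_newton_field:
  assumes "local_lipschitz (UNIV :: real set) \<Omega> (\<lambda>_. b)"
  shows "local_lipschitz (UNIV :: real set) (\<Omega> \<times> UNIV) (\<lambda>_. newton_field b)"
proof (rule local_lipschitzI)
  fix t :: real and x :: "(real^2) \<times> (real^2)"
  assume "x \<in> \<Omega> \<times> UNIV"
  then obtain z w where x: "x = (z, w)" and z: "z \<in> \<Omega>" by auto
  obtain u K where u: "u > 0" and K: "K-lipschitz_on (cball z u \<inter> \<Omega>) b"
  proof (rule local_lipschitzE[OF assms UNIV_I z, of t])
    fix u K assume uK: "u > 0" "\<And>s. s \<in> cball t u \<inter> UNIV \<Longrightarrow> K-lipschitz_on (cball z u \<inter> \<Omega>) b"
    from uK(2)[of t] uK(1) have "K-lipschitz_on (cball z u \<inter> \<Omega>) b" by simp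
    with uK(1) show ?thesis by (rule that)
  qed
  have K0: "K \<ge> 0" using K by (rule lipschitz_on_nonneg)
  define B where "B = \<bar>b z\<bar> + K * u"
  define W where "W = norm w + u"
  have "(1 + B + K * W)-lipschitz_on (cball x u \<inter> \<Omega> \<times> UNIV) (newton_field b)"
  proof (rule lipschitz_onI)
    show "0 \<le> 1 + B + K * W" using K0 u by (simp add: B_def W_def)
    fix y1 y2 assume y: "y1 \<in> cball x u \<inter> \<Omega> \<times> UNIV" "y2 \<in> cball x u \<inter> \<Omega> \<times> UNIV"
    obtain q1 v1 q2 v2 where eq: "y1 = (q1, v1)" "y2 = (q2, v2)" by (cases y1, cases y2)
    have mem: "q1 \<in> cball z u \<inter> \<Omega>" "q2 \<in> cball z u \<inter> \<Omega>" "dist w v2 \<le> u"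
      using y dist_fst_le[of x y1] dist_fst_le[of x y2] dist_snd_le[of x y2] by (auto simp: eq x)
    have d: "dist q1 q2 \<le> dist y1 y2" "dist v1 v2 \<le> dist y1 y2"
      using dist_fst_le[of y1 y2] dist_snd_le[of y1 y2] by (auto simp: eq)
    have "dist (b q1) (b z) \<le> K * dist q1 z"
      using lipschitz_onD[OF K mem(1)] z u by auto
    also have "\<dots> \<le> K * u" using mem K0 by (intro mult_left_mono) (auto simp: dist_commute)
    finally have B: "\<bar>b q1\<bar> \<le> B" by (auto simp: B_def dist_real_def)
    have "norm v2 \<le> W"
      using mem(3) norm_triangle_ineq2[of v2 w] by (simp add: W_def dist_norm norm_minus_commute)
    moreover have "\<bar>b q1 - b q2\<bar> \<le> K * dist y1 y2"
      using lipschitz_onD[OF K mem(1,2)] mult_left_mono[OF d(1) K0] by (simp add: dist_real_def)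
    ultimately have 1: "\<bar>b q1 - b q2\<bar> * norm v2 \<le> (K * dist y1 y2) * W"
      using K0 by (intro mult_mono) auto
    have 2: "\<bar>b q1\<bar> * norm (v1 - v2) \<le> B * dist y1 y2"
      using B d(2) by (intro mult_mono) (auto simp: dist_norm)
    interpret perp: bounded_linear perp by (rule bounded_linear_perp)
    have "dist (newton_field b y1) (newton_field b y2) = norm (v1 - v2, b q2 *\<^sub>R perp v2 - b q1 *\<^sub>R perp v1)"
      by (simp add: eq newton_field_eq dist_norm)
    also have "\<dots> \<le> norm (v1 - v2) + norm (b q2 *\<^sub>R perp v2 - b q1 *\<^sub>R perp v1)"
      by (rule norm_Pair_le)
    also have "b q2 *\<^sub>R perp v2 - b q1 *\<^sub>R perp v1
        = - (b q1 *\<^sub>R perp (v1 - v2) + (b q1 - b q2) *\<^sub>R perp v2)"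
      by (simp add: perp.diff algebra_simps)
    also have "norm \<dots> \<le> \<bar>b q1\<bar> * norm (v1 - v2) + \<bar>b q1 - b q2\<bar> * norm v2"
      unfolding norm_minus_cancel by (rule order_trans[OF norm_triangle_ineq]) simp
    finally have "dist (newton_field b y1) (newton_field b y2) \<le> dist y1 y2 + B * dist y1 y2 + (K * dist y1 y2) * W"
      using 1 2 d(2) by (simp add: dist_norm)
    then show "dist (newton_field b y1) (newton_field b y2) \<le> (1 + B + K * W) * dist y1 y2"
      by (simp add: algebra_simps)
  qed
  then show "\<exists>u>0. \<exists>L. \<forall>s\<in>cball t u \<inter> UNIV. L-lipschitz_on (cball x u \<inter> \<Omega> \<times> UNIV) (newton_field b)"
    using u by blast
qed

text \<open>At a finite end of a maximal solution the limits come one after the other. The position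
  converges because the speed is constant; once its limit is known to be interior, b is bounded near
  it, hence so is the acceleration, and the velocity converges too. The solution then extends,
  against maximality.\<close>

lemma newton_complete_if_boundary_unreachable:
  assumes \<Omega>: "open \<Omega>" and lip: "local_lipschitz (UNIV :: real set) \<Omega> (\<lambda>_. b)"
    and unreach: "\<And>J x. is_solution (newton_field b) (\<Omega> \<times> UNIV) J x \<Longrightarrow> \<not> reaches_boundary \<Omega> J x"
  shows "complete_dynamics (newton_field b) (\<Omega> \<times> UNIV)"
  unfolding complete_dynamics_def
proof (intro allI impI, rule ccontr)
  fix J x
  assume max: "is_maximal_solution (newton_field b) (\<Omega> \<times> UNIV) J x" and "J \<noteq> UNIV"
  then have sol: "is_solution (newton_field b) (\<Omega> \<times> UNIV) J x"
    by (simp add: is_maximal_solution_def)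
  then have J: "open J" "convex J" "J \<noteq> {}" by (auto simp: is_solution_def is_interval_convex_1)
  have "\<not> closed J" using clopen[of J] J \<open>J \<noteq> UNIV\<close> by blast
  then obtain T where T: "T \<in> closure J" "T \<notin> J"
    using closure_subset closed_closure by (metis subsetI subset_antisym)
  define q where "q t = fst (x t)" for t
  define v where "v t = snd (x t)" for t
  have q: "q t \<in> \<Omega>" "(q has_vector_derivative v t) (at t)"
    and v: "(v has_vector_derivative - (b (q t) *\<^sub>R perp (v t))) (at t)" if "t \<in> J" for t
    using newton_solution_components[OF sol that] unfolding q_def[abs_def] v_def[abs_def] by auto
  obtain V where V: "\<And>t. t \<in> J \<Longrightarrow> norm (v t) = V"
    using newton_speed_constant[OF sol] unfolding v_def by blast
  obtain z where z: "(q \<longlongrightarrow> z) (at T within J)"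
    using bounded_derivative_has_limit[OF J(2) q(2) _ T(1), of V] V by auto
  have nontriv: "at T within J \<noteq> bot"
    using T by (simp add: trivial_limit_within islimpt_in_closure)
  have "\<forall>\<^sub>F t in at T within J. q t \<in> closure \<Omega>"
    using q(1) closure_subset[of \<Omega>] by (auto simp: eventually_at_topological intro!: exI[of _ UNIV])
  then have "z \<in> closure \<Omega>"
    using Lim_in_closed_set[OF closed_closure _ nontriv z] by blast
  moreover have "z \<notin> frontier \<Omega>"
    using unreach[OF sol] T(1) z unfolding reaches_boundary_def q_def[abs_def] by blast
  ultimately have z\<Omega>: "z \<in> \<Omega>" using \<Omega> by (simp add: frontier_def interior_open)
  have "isCont b z"
    using local_lipschitz_continuous_on[OF lip UNIV_I] \<Omega> z\<Omega> by (simp add: continuous_on_eq_continuous_at)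
  then have "((\<lambda>t. b (q t)) \<longlongrightarrow> b z) (at T within J)"
    using z by (rule isCont_tendsto_compose)
  then have "\<forall>\<^sub>F t in at T within J. dist (b (q t)) (b z) < 1"
    by (rule tendstoD) simp
  then obtain r where r: "r > 0" "\<And>t. t \<in> J \<Longrightarrow> t \<noteq> T \<Longrightarrow> dist t T < r \<Longrightarrow> dist (b (q t)) (b z) < 1"
    unfolding eventually_at by blast
  define S where "S = J \<inter> ball T r"
  have "convex S" using J by (simp add: S_def convex_Int)
  moreover have "norm (- (b (q t) *\<^sub>R perp (v t))) \<le> (\<bar>b z\<bar> + 1) * V" if "t \<in> S" for t
  proof -
    have t: "t \<in> J" "dist (b (q t)) (b z) < 1"
      using that T(2) r(2)[of t] by (auto simp: S_def dist_commute)
    then have "\<bar>b (q t)\<bar> \<le> \<bar>b z\<bar> + 1" by (simp add: dist_real_def)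
    then show ?thesis using V[OF t(1)] norm_ge_zero[of "v t"] by (simp add: mult_right_mono)
  qed
  moreover have "T \<in> closure S"
  proof -
    have "closure J \<inter> ball T r \<subseteq> closure S"
      unfolding S_def by (metis Int_commute open_Int_closure_subset open_ball)
    then show ?thesis using T(1) r(1) by auto
  qed
  moreover have "(v has_vector_derivative - (b (q t) *\<^sub>R perp (v t))) (at t)" if "t \<in> S" for t
    using v that by (simp add: S_def)
  ultimately obtain w where "(v \<longlongrightarrow> w) (at T within S)"
    using bounded_derivative_has_limit[of S v "\<lambda>t. - (b (q t) *\<^sub>R perp (v t))" "(\<bar>b z\<bar> + 1) * V" T] by blast
  moreover have "at T within S = at T within J"
    using r(1) unfolding S_def by (intro at_within_nhd[of T "ball T r"]) auto
  ultimately have "((\<lambda>t. (q t, v t)) \<longlongrightarrow> (z, w)) (at T within J)"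
    using z by (auto intro: tendsto_Pair)
  then have "(x \<longlongrightarrow> (z, w)) (at T within J)" by (simp add: q_def v_def)
  moreover have "(z, w) \<in> \<Omega> \<times> UNIV" using z\<Omega> by simp
  moreover have "open (\<Omega> \<times> (UNIV :: (real^2) set))" using \<Omega> by (simp add: open_Times)
  ultimately obtain J' y where "is_solution (newton_field b) (\<Omega> \<times> UNIV) J' y" "J \<subset> J'" "\<And>t. t \<in> J \<Longrightarrow> y t = x t"
    using solution_extends[OF local_lipschitz_newton_field[OF lip] _ sol T] by metis
  then show False using max unfolding is_maximal_solution_def by blast
qed

section \<open>Hamiltonian formulation\<close>

text \<open>The second component is the transpose of \<open>A'\<close> applied to the velocity p -
  A(q), written through the basis vectors.\<close>

lemma hamiltonian_field_eq:
  assumes A: "(A has_derivative A') (at q)"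
  shows "hamiltonian_field (magnetic_hamiltonian A) (q, p) =
    (p - A q, \<chi> i. (p - A q) \<bullet> A' (axis i 1))"
proof -
  interpret A': linear A' using A by (rule has_derivative_linear)
  have H: "magnetic_hamiltonian A (q, p) = 1/2 * ((p - A q) \<bullet> (p - A q))" for q p
    by (simp add: magnetic_hamiltonian_def power2_norm_eq_inner)
  have "((\<lambda>p'. magnetic_hamiltonian A (q, p')) has_derivative (\<lambda>h. (p - A q) \<bullet> h)) (at p)"
    unfolding H by (auto intro!: derivative_eq_intros simp: inner_commute)
  from frechet_derivative_at[OF this, symmetric]
  have p: "frechet_derivative (\<lambda>p'. magnetic_hamiltonian A (q, p')) (at p) = (\<lambda>h. (p - A q) \<bullet> h)" .
  have "((\<lambda>q'. magnetic_hamiltonian A (q', p)) has_derivative (\<lambda>h. - ((p - A q) \<bullet> A' h))) (at q)"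
    unfolding H by (auto intro!: derivative_eq_intros A simp: inner_commute)
  from frechet_derivative_at[OF this, symmetric]
  have q: "frechet_derivative (\<lambda>q'. magnetic_hamiltonian A (q', p)) (at q) = (\<lambda>h. - ((p - A q) \<bullet> A' h))" .
  show ?thesis
    by (simp add: hamiltonian_field_def p q inner_axis vec_eq_iff)
qed

text \<open>The transpose of \<open>A'\<close> minus \<open>A'\<close> is an antisymmetric 2 by 2
  matrix, hence a multiple of the quarter turn; the multiple is minus the curl.\<close>

lemma lorentz_force_from_potential:
  assumes A': "linear A'" and curl: "A' (axis 1 1) $ 2 - A' (axis 2 1) $ 1 = \<beta>"
  shows "(\<chi> i. v \<bullet> A' (axis i 1)) - A' v = - (\<beta> *\<^sub>R perp v)"
proof -
  interpret linear A' by fact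
  have "v = v $ 1 *\<^sub>R axis 1 1 + v $ 2 *\<^sub>R axis 2 1"
    by (simp add: vec_eq_2 axis_def)
  then have "A' v = A' (v $ 1 *\<^sub>R axis 1 1 + v $ 2 *\<^sub>R axis 2 1)" by simp
  then have "A' v = v $ 1 *\<^sub>R A' (axis 1 1) + v $ 2 *\<^sub>R A' (axis 2 1)"
    by (simp only: add scale)
  then show ?thesis
    by (simp add: vec_eq_2 inner_2 curl[symmetric] algebra_simps)
qed

lemma vector_potential_derivative:
  assumes "vector_potential \<Omega> b A" "open \<Omega>" "q \<in> \<Omega>"
  obtains A' where "(A has_derivative A') (at q)" "linear A'"
    "A' (axis 1 1) $ 2 - A' (axis 2 1) $ 1 = b q"
proof -
  have "A differentiable (at q)"
    using assms by (auto simp: vector_potential_def differentiable_on_eq_differentiable_at)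
  then have "(A has_derivative frechet_derivative A (at q)) (at q)"
    by (simp add: frechet_derivative_works)
  then show ?thesis
    using that[of "frechet_derivative A (at q)"] assms
    by (auto simp: vector_potential_def dest: has_derivative_linear)
qed

text \<open>With v = p - A(q), the transpose of \<open>A'\<close> at v is p' and \<open>A'\<close>
  at v is the derivative of A along the motion. Their difference is the Lorentz force.\<close>

lemma hamiltonian_imp_newton:
  assumes pot: "vector_potential \<Omega> b A" and \<Omega>: "open \<Omega>"
    and sol: "is_solution (hamiltonian_field (magnetic_hamiltonian A)) (\<Omega> \<times> UNIV) J x"
  shows "is_solution (newton_field b) (\<Omega> \<times> UNIV) J (\<lambda>t. (fst (x t), snd (x t) - A (fst (x t))))"
proof -
  have "((\<lambda>t. (fst (x t), snd (x t) - A (fst (x t)))) has_vector_derivative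
      newton_field b (fst (x t), snd (x t) - A (fst (x t)))) (at t)" if "t \<in> J" for t
  proof -
    obtain q p where x: "x t = (q, p)" by (cases "x t")
    have q: "q \<in> \<Omega>" and d: "(x has_vector_derivative hamiltonian_field (magnetic_hamiltonian A) (q, p)) (at t)"
      using sol that x unfolding is_solution_def by fastforce+
    obtain A' where A': "(A has_derivative A') (at q)" "linear A'"
      "A' (axis 1 1) $ 2 - A' (axis 2 1) $ 1 = b q"
      using vector_potential_derivative[OF pot \<Omega> q] by blast
    let ?p' = "\<chi> i. (p - A q) \<bullet> A' (axis i 1)"
    note d = d[unfolded hamiltonian_field_eq[OF A'(1)]]
    have dq: "((\<lambda>t. fst (x t)) has_vector_derivative p - A q) (at t)"
      using bounded_linear.has_vector_derivative[OF bounded_linear_fst d] by simp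
    have dp: "((\<lambda>t. snd (x t)) has_vector_derivative ?p') (at t)"
      using bounded_linear.has_vector_derivative[OF bounded_linear_snd d] by simp
    have "((\<lambda>t. A (fst (x t))) has_derivative (\<lambda>h. A' (h *\<^sub>R (p - A q)))) (at t)"
      using has_derivative_compose[OF dq[unfolded has_vector_derivative_def], of A A'] A'(1) x by simp
    then have dA: "((\<lambda>t. A (fst (x t))) has_vector_derivative A' (p - A q)) (at t)"
      by (simp add: has_vector_derivative_def linear_scale[OF A'(2)])
    show ?thesis
      using has_vector_derivative_Pair[OF dq has_vector_derivative_diff[OF dp dA]]
      by (simp add: x newton_field_eq lorentz_force_from_potential[OF A'(2,3)])
  qed
  then show ?thesis using sol by (auto simp: is_solution_def)
qed

text \<open>Maximality quantifies over all extensions, so an extension found for Newton's equation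
  has to be carried back. The same force identity is solved for p'.\<close>

lemma newton_imp_hamiltonian:
  assumes pot: "vector_potential \<Omega> b A" and \<Omega>: "open \<Omega>"
    and sol: "is_solution (newton_field b) (\<Omega> \<times> UNIV) J x"
  shows "is_solution (hamiltonian_field (magnetic_hamiltonian A)) (\<Omega> \<times> UNIV) J
    (\<lambda>t. (fst (x t), snd (x t) + A (fst (x t))))"
proof -
  have "((\<lambda>t. (fst (x t), snd (x t) + A (fst (x t)))) has_vector_derivative
      hamiltonian_field (magnetic_hamiltonian A) (fst (x t), snd (x t) + A (fst (x t)))) (at t)" if "t \<in> J" for t
  proof -
    let ?q = "fst (x t)" and ?v = "snd (x t)"
    note d = newton_solution_components[OF sol that]
    obtain A' where A': "(A has_derivative A') (at ?q)" "linear A'"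
      "A' (axis 1 1) $ 2 - A' (axis 2 1) $ 1 = b ?q"
      using vector_potential_derivative[OF pot \<Omega> d(1)] by blast
    have "((\<lambda>t. A (fst (x t))) has_derivative (\<lambda>h. A' (h *\<^sub>R ?v))) (at t)"
      using has_derivative_compose[OF d(2)[unfolded has_vector_derivative_def] A'(1)] .
    then have dA: "((\<lambda>t. A (fst (x t))) has_vector_derivative A' ?v) (at t)"
      by (simp add: has_vector_derivative_def linear_scale[OF A'(2)])
    have "- (b ?q *\<^sub>R perp ?v) + A' ?v = (\<chi> i. ?v \<bullet> A' (axis i 1))"
      unfolding lorentz_force_from_potential[OF A'(2,3), symmetric] by simp
    then show ?thesis
      using has_vector_derivative_Pair[OF d(2) has_vector_derivative_add[OF d(3) dA]]
      by (simp add: hamiltonian_field_eq[OF A'(1)])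
  qed
  then show ?thesis using sol by (auto simp: is_solution_def)
qed

text \<open>The two changes of variables are mutually inverse and keep the time interval. Thus a
  proper extension of the transformed solution would give one of the original solution.\<close>

lemma hamiltonian_complete_if_newton_complete:
  assumes pot: "vector_potential \<Omega> b A" and \<Omega>: "open \<Omega>"
    and newton: "complete_dynamics (newton_field b) (\<Omega> \<times> UNIV)"
  shows "complete_dynamics (hamiltonian_field (magnetic_hamiltonian A)) (\<Omega> \<times> UNIV)"
  unfolding complete_dynamics_def
proof (intro allI impI)
  fix J x
  assume max: "is_maximal_solution (hamiltonian_field (magnetic_hamiltonian A)) (\<Omega> \<times> UNIV) J x"
  let ?y = "\<lambda>t. (fst (x t), snd (x t) - A (fst (x t)))"
  have "is_maximal_solution (newton_field b) (\<Omega> \<times> UNIV) J ?y"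
    unfolding is_maximal_solution_def
  proof (intro conjI allI impI)
    show "is_solution (newton_field b) (\<Omega> \<times> UNIV) J ?y"
      using hamiltonian_imp_newton[OF pot \<Omega>] max by (simp add: is_maximal_solution_def)
    fix J' y
    assume y: "is_solution (newton_field b) (\<Omega> \<times> UNIV) J' y \<and> J \<subseteq> J' \<and> (\<forall>t\<in>J. y t = ?y t)"
    have "is_solution (hamiltonian_field (magnetic_hamiltonian A)) (\<Omega> \<times> UNIV) J'
        (\<lambda>t. (fst (y t), snd (y t) + A (fst (y t))))"
      using newton_imp_hamiltonian[OF pot \<Omega>] y by blast
    moreover have "\<forall>t\<in>J. (fst (y t), snd (y t) + A (fst (y t))) = x t"
      using y by simp
    ultimately show "J' = J"
      using max y unfolding is_maximal_solution_def by blast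
  qed
  then show "J = UNIV" using newton unfolding complete_dynamics_def by blast
qed

theorem theorem2p1:
  fixes \<Omega> :: "(real^2) set"
    and b :: "real^2 \<Rightarrow> real"
    and \<gamma> :: "(real^2) set \<Rightarrow> real \<Rightarrow> real^2"
    and L \<delta> :: "(real^2) set \<Rightarrow> real"
  assumes domain: "smooth_bounded_domain \<Omega>"
    and b_Lipschitz: "local_lipschitz (UNIV :: real set) \<Omega> (\<lambda>_. b)"
    and boundary_curve: "\<And>C. C \<in> components (frontier \<Omega>) \<Longrightarrow>
          arclength_parametrization (\<gamma> C) (L C) C \<and> inward_oriented \<Omega> (\<gamma> C)"
    and chart: "\<And>C. C \<in> components (frontier \<Omega>) \<Longrightarrow>
          tubular_chart \<Omega> C (\<gamma> C) (L C) (\<delta> C)"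
    and finite_integrals: "\<And>C n. C \<in> components (frontier \<Omega>) \<Longrightarrow> 0 < n \<Longrightarrow> n < \<delta> C \<Longrightarrow>
          (\<lambda>\<eta>. integral {0..L C} (\<lambda>\<xi>. tubular_field b (\<gamma> C) \<eta> \<xi>)) integrable_on {n..\<delta> C}"
    and divergence: "\<And>C. C \<in> components (frontier \<Omega>) \<Longrightarrow>
          filterlim (\<lambda>n. \<bar>integral {n..\<delta> C}
              (\<lambda>\<eta>. integral {0..L C} (\<lambda>\<xi>. tubular_field b (\<gamma> C) \<eta> \<xi>))\<bar>)
            at_top (at_right 0)"
    and oscillation: "\<And>C. C \<in> components (frontier \<Omega>) \<Longrightarrow>
          \<exists>M\<ge>0. \<forall>n\<in>{0<..<\<delta> C}. \<forall>s.
            \<bar>tubular_field b (\<gamma> C) n s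
              - 1 / L C * integral {0..L C} (\<lambda>\<xi>. tubular_field b (\<gamma> C) n \<xi>)\<bar> \<le> M"
  shows "complete_dynamics (newton_field b) (\<Omega> \<times> UNIV)
    \<and> (\<forall>A. vector_potential \<Omega> b A \<longrightarrow>
          complete_dynamics (hamiltonian_field (magnetic_hamiltonian A)) (\<Omega> \<times> UNIV))
    \<and> (\<forall>J x. is_solution (newton_field b) (\<Omega> \<times> UNIV) J x \<longrightarrow> \<not> reaches_boundary \<Omega> J x)"
proof -
  have \<Omega>: "open \<Omega>" using domain by (simp add: smooth_bounded_domain_def)
  have unreach: "\<not> reaches_boundary \<Omega> J x" if sol: "is_solution (newton_field b) (\<Omega> \<times> UNIV) J x" for J x
  proof
    assume "reaches_boundary \<Omega> J x"
    then obtain T z where T: "T \<in> closure J" and z: "z \<in> frontier \<Omega>"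
      and lim: "((\<lambda>t. fst (x t)) \<longlongrightarrow> z) (at T within J)"
      unfolding reaches_boundary_def by blast
    \<comment> \<open>The limit point singles out one boundary component, and the estimates are
      carried out in the chart of that component.\<close>
    obtain C where C: "C \<in> components (frontier \<Omega>)" and zC: "z \<in> C"
      using z Union_components[of "frontier \<Omega>"] by blast
    interpret tubular_neighborhood "\<gamma> C" "L C" C \<Omega> "\<delta> C"
      using boundary_curve[OF C] chart[OF C] domain C by unfold_locales auto
    obtain M where M: "M \<ge> 0" "\<forall>n\<in>{0<..<\<delta> C}. \<forall>s. \<bar>tubular_field b (\<gamma> C) n s
        - 1 / L C * integral {0..L C} (\<lambda>\<xi>. tubular_field b (\<gamma> C) n \<xi>)\<bar> \<le> M"
      using oscillation[OF C] by blast
    show False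
      by (rule no_boundary_limit[OF local_lipschitz_continuous_on[OF b_Lipschitz UNIV_I]
            finite_integrals[OF C] divergence[OF C] M(1) _ sol T lim zC])
        (use M(2) in auto)
  qed
  have "complete_dynamics (newton_field b) (\<Omega> \<times> UNIV)"
    by (rule newton_complete_if_boundary_unreachable[OF \<Omega> b_Lipschitz unreach])
  then show ?thesis
    using hamiltonian_complete_if_newton_complete[OF _ \<Omega>] unreach by blast
qed

end
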